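(* Let $P\subset\mathbb{R}^n$ be a simplicial lattice polytope containing the origin as an interior point, let $H^{2*}_{\mathrm{orb}}(\mathcal{X})$ be its orbifold cohomology with the mixed Hodge structure $\mathrm{MHS}_{\mathrm{orb}}$ defined by a Poincaré–Lefschetz conjugation, and let $h^{p,q}=\dim\mathrm{gr}^p_F\mathrm{gr}^W_{p+q}H^{2*}_{\mathrm{orb}}(\mathcal{X})=h_0^{p,q}+h_{\neq0}^{p,q}$ be its Hodge numbers. Then, for $p,q\in\mathbb{Z}$, $$h_0^{p,q}=\sum_{\ell\in F,\ i_\ell\in\mathbb{Z},\ i_\ell-i_{\ell^{-1}}=q-p}\dim H^{2(n_\ell+i_{\ell^{-1}}-p)}(X_\ell)$$ and $$h_{\neq0}^{p,q}=\sum_{\ell\in F,\ i_\ell\notin\mathbb{Z},\ [i_\ell]-[i_{\ell^{-1}}]=q-p}\dim H^{2(n_\ell+[i_{\ell^{-1}}]-p)}(X_\ell).$$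
   Context: **Orbifold cohomology.** $\mathcal{V}(P)$ is the set of vertices of $P$, $\Sigma_P$ the fan of cones over the faces of $P$, $\mathcal{X}$ the toric Deligne–Mumford stack (Borisov–Chen–Smith) of the stacky fan $(\mathbb{Z}^n,\Sigma_P,\mathcal{V}(P))$. For $\sigma\in\Sigma_P$, $\mathrm{Box}(\sigma)$ is the set of $v\in\mathbb{Z}^n$ of the form $v=\sum q_bb$, sum over the vertices $b$ of $P$ generating the rays of $\sigma$, with all $0<q_b<1$ (so $\mathrm{Box}(\{0\})=\{0\}$). The set of labels of the sectors is $F=\bigcup_\sigma\mathrm{Box}(\sigma)$. For $\ell=\sum q_bb\in F$: $\sigma(\ell)$ is the smallest cone containing $\ell$; $X_\ell$ (underlying space of the sector) is the simplicial toric variety of the quotient fan $\Sigma_P/\sigma(\ell)$; $n_\ell=\dim X_\ell=n-\dim\sigma(\ell)$; the age is $i_\ell=\sum q_b$; $\ell^{-1}=\sum(1-q_b)b\in F$. One has $n_\ell+i_\ell+i_{\ell^{-1}}=n$. $H^k(X_\ell)$ means $H^k(X_\ell;\mathbb{C})$ and $H^{2\alpha}_{\mathrm{orb}}(\mathcal{X})=\bigoplus_{\ell\in F}H^{2(\alpha-i_\ell)}(X_\ell)$, $\alpha\in\mathbb{Q}$ (summands are $0$ unless $\alpha-i_\ell\in\mathbb{Z}_{\ge0}$). $[x]$ is the integer part. $H^{2*}_{\mathrm{orb}}(\mathcal{X})_0$ (resp. $H^{2*}_{\mathrm{orb}}(\mathcal{X})_{\neq0}$) is the direct sum of the contributions of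 the sectors with $i_\ell\in\mathbb{Z}$ (resp. $i_\ell\notin\mathbb{Z}$), so $H^{2*}_{\mathrm{orb}}(\mathcal{X})=H^{2*}_{\mathrm{orb}}(\mathcal{X})_0\oplus H^{2*}_{\mathrm{orb}}(\mathcal{X})_{\neq0}$. **Filtrations.** For $p,m\in\mathbb{Z}$: if $i_\ell\in\mathbb{Z}$, $F^pH^{2*}(X_\ell)=\bigoplus_{i\ge p}H^{2(n-i-i_\ell)}(X_\ell)$ and $W_mH^{2*}(X_\ell)=\bigoplus_{n+n_\ell-m\le2j}H^{2j}(X_\ell)$; if $i_\ell\notin\mathbb{Z}$, $F^pH^{2*}(X_\ell)=\bigoplus_{i\ge p}H^{2(n-1-i-[i_\ell])}(X_\ell)$ and $W_mH^{2*}(X_\ell)=\bigoplus_{n-1+n_\ell-m\le2j}H^{2j}(X_\ell)$. $F^p$ and $W_m$ on $H^{2*}_{\mathrm{orb}}(\mathcal{X})$ are the direct sums over $\ell\in F$. **Mixed Hodge structure.** A Poincaré–Lefschetz conjugation is a $\mathbb{C}$-antilinear involution with $\overline{H^{2i}(X_\ell)}\subset\bigoplus_{j\ge i}H^{2j}(X_{\ell^{-1}})$ for all $\ell\in F$ and all $i$. $\mathrm{MHS}_{\mathrm{orb}}$ consists of $H^{2*}_{\mathrm{orb}}(\mathcal{X})$, the real form fixed by the conjugation, $F^\bullet$ and $W_\bullet$. The numbers $h_0^{p,q}$ and $h_{\neq0}^{p,q}$ are $\dim\mathrm{gr}^p_F\mathrm{gr}^W_{p+q}$ of $H^{2*}_{\mathrm{orb}}(\mathcal{X})_0$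 and $H^{2*}_{\mathrm{orb}}(\mathcal{X})_{\neq0}$ respectively. *)

theory Defs
  imports
    "HOL-Analysis.Analysis"
    "HOL-Homology.Homology"
    "HOL-Library.Extended_Nat"
    "Jordan_Normal_Form.Missing_VectorSpace"
begin

section \<open>Complex vector spaces with explicit carriers\<close>

definition complex_field :: "complex ring" where
  "complex_field = \<lparr>carrier = UNIV, mult = (*), one = 1, zero = 0, add = (+)\<rparr>"

text \<open>The dimension is an extended natural number: the value is infinite when there is no finite
  generating set, so no finiteness result is built into statements about dimensions.\<close>

definition vdim :: "(complex, 'a, 'm) module_scheme \<Rightarrow> enat" where
  "vdim V = (if vectorspace.fin_dim complex_field V
             then enat (vectorspace.dim complex_field V) else \<infinity>)"

text \<open>The fields \<open>mult\<close> and \<open>one\<close> of the module records below are not part of the vector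
  space structure and are left unspecified.\<close>

definition quotient_space :: "(complex, 'a, 'm) module_scheme \<Rightarrow> 'a set \<Rightarrow> (complex, 'a set) module"
  where "quotient_space V U =
    \<lparr>carrier = a_rcosets\<^bsub>V\<^esub> U, mult = undefined, one = undefined, zero = U,
     add = (\<lambda>A B. A <+>\<^bsub>V\<^esub> B), smult = (\<lambda>c A. \<Union>x\<in>A. U +>\<^bsub>V\<^esub> (c \<odot>\<^bsub>V\<^esub> x))\<rparr>"

definition family_sum :: "'i set \<Rightarrow> ('i \<Rightarrow> (complex, 'a, 'm) module_scheme) \<Rightarrow> (complex, 'i \<Rightarrow> 'a) module"
  where "family_sum I V =
    \<lparr>carrier = {x \<in> (\<Pi>\<^sub>E i\<in>I. carrier (V i)). finite {i \<in> I. x i \<noteq> \<zero>\<^bsub>V i\<^esub>}},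
     mult = undefined, one = undefined,
     zero = (\<lambda>i\<in>I. \<zero>\<^bsub>V i\<^esub>),
     add = (\<lambda>x y. \<lambda>i\<in>I. x i \<oplus>\<^bsub>V i\<^esub> y i),
     smult = (\<lambda>c x. \<lambda>i\<in>I. c \<odot>\<^bsub>V i\<^esub> x i)\<rparr>"

section \<open>Singular cohomology with complex coefficients\<close>

definition cochain_space :: "nat \<Rightarrow> 'a topology \<Rightarrow> (complex, 'a chain \<Rightarrow> complex) module" where
  "cochain_space k X =
    \<lparr>carrier = hom (chain_group k X) (add_monoid complex_field)
                 \<inter> extensional (carrier (chain_group k X)),
     mult = undefined, one = undefined,
     zero = (\<lambda>c\<in>carrier (chain_group k X). 0),
     add = (\<lambda>f g. \<lambda>c\<in>carrier (chain_group k X). f c + g c),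
     smult = (\<lambda>a f. \<lambda>c\<in>carrier (chain_group k X). a * f c)\<rparr>"

definition coboundary :: "nat \<Rightarrow> 'a topology \<Rightarrow> ('a chain \<Rightarrow> complex) \<Rightarrow> ('a chain \<Rightarrow> complex)" where
  "coboundary k X f = (\<lambda>c\<in>carrier (chain_group (Suc k) X). f (chain_boundary (Suc k) c))"

definition cocycles :: "nat \<Rightarrow> 'a topology \<Rightarrow> ('a chain \<Rightarrow> complex) set" where
  "cocycles k X =
    {f \<in> carrier (cochain_space k X). coboundary k X f = \<zero>\<^bsub>cochain_space (Suc k) X\<^esub>}"

definition coboundaries :: "nat \<Rightarrow> 'a topology \<Rightarrow> ('a chain \<Rightarrow> complex) set" where
  "coboundaries k X =
    (case k of 0 \<Rightarrow> {\<zero>\<^bsub>cochain_space 0 X\<^esub>}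
     | Suc i \<Rightarrow> coboundary i X ` carrier (cochain_space i X))"

definition cohomology :: "nat \<Rightarrow> 'a topology \<Rightarrow> (complex, ('a chain \<Rightarrow> complex) set) module" where
  "cohomology k X =
    quotient_space ((cochain_space k X)\<lparr>carrier := cocycles k X\<rparr>) (coboundaries k X)"

section \<open>Toric varieties\<close>

definition int_vectors :: "(real ^ 'n) set" where
  "int_vectors = {v. \<forall>i. v $ i \<in> \<int>}"

text \<open>The dual lattice is identified with the integer vectors by means of the inner product.\<close>

definition dual_semigroup :: "(real ^ 'n) set \<Rightarrow> (real ^ 'n) set" where
  "dual_semigroup \<tau> = {m \<in> int_vectors. \<forall>v\<in>\<tau>. 0 \<le> m \<bullet> v}"

text \<open>The affine toric variety of a cone is the space of monoid homomorphisms from its dual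
  semigroup to the multiplicative monoid of complex numbers, with the topology of pointwise
  convergence. This is its complex analytic topology: finitely many generators of the semigroup
  embed it as a closed subset of an affine space.\<close>

definition toric_chart :: "(real ^ 'n) set \<Rightarrow> ((real ^ 'n) \<Rightarrow> complex) topology" where
  "toric_chart \<tau> =
    subtopology (product_topology (\<lambda>_. euclidean) (dual_semigroup \<tau>))
      {x. x 0 = 1 \<and> (\<forall>m\<in>dual_semigroup \<tau>. \<forall>m'\<in>dual_semigroup \<tau>. x (m + m') = x m * x m')}"

text \<open>The charts of two cones of a fan are glued along the chart of their intersection, which is
  a common face and whose chart is embedded in both by restriction of homomorphisms.\<close>

definition toric_gluing ::
  "(real ^ 'n) set set \<Rightarrow> (((real ^ 'n) set \<times> ((real ^ 'n) \<Rightarrow> complex)) \<times>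
                         ((real ^ 'n) set \<times> ((real ^ 'n) \<Rightarrow> complex))) set" where
  "toric_gluing \<Sigma> =
    {((\<tau>, x), (\<tau>', x')) | \<tau> x \<tau>' x'. \<tau> \<in> \<Sigma> \<and> \<tau>' \<in> \<Sigma> \<and>
       (\<exists>y \<in> topspace (toric_chart (\<tau> \<inter> \<tau>')).
          x = restrict y (dual_semigroup \<tau>) \<and> x' = restrict y (dual_semigroup \<tau>'))}"

definition glued_topology :: "'a topology \<Rightarrow> ('a \<times> 'a) set \<Rightarrow> 'a set topology" where
  "glued_topology X r =
    topology (\<lambda>U. U \<subseteq> topspace X // r \<and> openin X {x \<in> topspace X. r `` {x} \<in> U})"

lemma openin_glued_topology:
  "openin (glued_topology X r) U \<longleftrightarrow>
     U \<subseteq> topspace X // r \<and> openin X {x \<in> topspace X. r `` {x} \<in> U}"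
proof -
  have "istopology (\<lambda>U. U \<subseteq> topspace X // r \<and> openin X {x \<in> topspace X. r `` {x} \<in> U})"
    unfolding istopology_def
  proof (intro conjI allI impI)
    fix S T
    assume S: "S \<subseteq> topspace X // r \<and> openin X {x \<in> topspace X. r `` {x} \<in> S}"
      and T: "T \<subseteq> topspace X // r \<and> openin X {x \<in> topspace X. r `` {x} \<in> T}"
    show "S \<inter> T \<subseteq> topspace X // r" using S by blast
    have "{x \<in> topspace X. r `` {x} \<in> S \<inter> T} =
        {x \<in> topspace X. r `` {x} \<in> S} \<inter> {x \<in> topspace X. r `` {x} \<in> T}" by blast
    then show "openin X {x \<in> topspace X. r `` {x} \<in> S \<inter> T}" using S T by auto
  next
    fix K
    assume K: "\<forall>U\<in>K. U \<subseteq> topspace X // r \<and> openin X {x \<in> topspace X. r `` {x} \<in> U}"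
    show "\<Union>K \<subseteq> topspace X // r" using K by blast
    have "{x \<in> topspace X. r `` {x} \<in> \<Union>K} = (\<Union>U\<in>K. {x \<in> topspace X. r `` {x} \<in> U})" by blast
    then show "openin X {x \<in> topspace X. r `` {x} \<in> \<Union>K}" using K by auto
  qed
  then show ?thesis by (simp add: glued_topology_def topology_inverse')
qed

text \<open>\<open>\<Sigma>\<close> is a fan in the integer lattice, or more generally a fan in the quotient of the integer
  lattice by its intersection with a rational subspace \<open>L\<close>, whose cones are represented by their
  preimages in the ambient space. The dual lattice of that quotient consists of the
  integer vectors orthogonal to \<open>L\<close>, so the dual semigroup of a cone of the
  quotient is the dual semigroup of its preimage.\<close>

definition toric_variety ::
  "(real ^ 'n) set set \<Rightarrow> ((real ^ 'n) set \<times> ((real ^ 'n) \<Rightarrow> complex)) set topology" where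
  "toric_variety \<Sigma> = glued_topology (sum_topology toric_chart \<Sigma>) (toric_gluing \<Sigma>)"

text \<open>The quotient fan consists of the images modulo the linear span of \<open>\<sigma>\<close> of the cones
  having \<open>\<sigma>\<close> as a face; each image is represented by its preimage.\<close>

definition quotient_fan :: "(real ^ 'n) set set \<Rightarrow> (real ^ 'n) set \<Rightarrow> (real ^ 'n) set set" where
  "quotient_fan \<Sigma> \<sigma> = {{u + v | u v. u \<in> \<tau> \<and> v \<in> span \<sigma>} | \<tau>. \<tau> \<in> \<Sigma> \<and> \<sigma> face_of \<tau>}"

section \<open>Simplicial lattice polytopes and sectors\<close>

definition vertices :: "(real ^ 'n) set \<Rightarrow> (real ^ 'n) set" where
  "vertices P = {b. b extreme_point_of P}"

definition simplicial_lattice_polytope :: "(real ^ 'n) set \<Rightarrow> bool" where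
  "simplicial_lattice_polytope P \<longleftrightarrow>
     polytope P \<and> vertices P \<subseteq> int_vectors \<and>
     (\<forall>S. S face_of P \<and> S \<noteq> P \<longrightarrow> (\<exists>k. k simplex S))"

text \<open>The empty face of \<open>P\<close> contributes the cone \<open>{0}\<close>.\<close>

definition face_fan :: "(real ^ 'n) set \<Rightarrow> (real ^ 'n) set set" where
  "face_fan P = {convex_cone hull S | S. S face_of P \<and> S \<noteq> P}"

definition ray_vertices :: "(real ^ 'n) set \<Rightarrow> (real ^ 'n) set \<Rightarrow> (real ^ 'n) set" where
  "ray_vertices P \<sigma> = {b \<in> vertices P. (convex_cone hull {b}) face_of \<sigma>}"

definition Box :: "(real ^ 'n) set \<Rightarrow> (real ^ 'n) set \<Rightarrow> (real ^ 'n) set" where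
  "Box P \<sigma> = {v \<in> int_vectors. \<exists>q. v = (\<Sum>b\<in>ray_vertices P \<sigma>. q b *\<^sub>R b) \<and>
                                 (\<forall>b\<in>ray_vertices P \<sigma>. 0 < q b \<and> q b < 1)}"

definition sectors :: "(real ^ 'n) set \<Rightarrow> (real ^ 'n) set" where
  "sectors P = (\<Union>\<sigma>\<in>face_fan P. Box P \<sigma>)"

text \<open>The order on sets is inclusion, so this is the smallest cone containing \<open>l\<close>.\<close>

definition sector_cone :: "(real ^ 'n) set \<Rightarrow> (real ^ 'n) \<Rightarrow> (real ^ 'n) set" where
  "sector_cone P l = (LEAST \<sigma>. \<sigma> \<in> face_fan P \<and> l \<in> \<sigma>)"

text \<open>The vertices on the rays of a simplicial cone are linearly independent, so the
  coefficients are unique.\<close>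

definition box_coeff :: "(real ^ 'n) set \<Rightarrow> (real ^ 'n) \<Rightarrow> (real ^ 'n) \<Rightarrow> real" where
  "box_coeff P l = (THE q. l = (\<Sum>b\<in>ray_vertices P (sector_cone P l). q b *\<^sub>R b) \<and>
                           (\<forall>b. b \<notin> ray_vertices P (sector_cone P l) \<longrightarrow> q b = 0))"

definition age :: "(real ^ 'n) set \<Rightarrow> (real ^ 'n) \<Rightarrow> real" where
  "age P l = (\<Sum>b\<in>ray_vertices P (sector_cone P l). box_coeff P l b)"

definition sector_inv :: "(real ^ 'n) set \<Rightarrow> (real ^ 'n) \<Rightarrow> (real ^ 'n)" where
  "sector_inv P l = (\<Sum>b\<in>ray_vertices P (sector_cone P l). (1 - box_coeff P l b) *\<^sub>R b)"

definition sector_dim :: "(real ^ 'n) set \<Rightarrow> (real ^ 'n) \<Rightarrow> int" where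
  "sector_dim P l = int CARD('n) - int (dim (sector_cone P l))"

definition sector_space ::
  "(real ^ 'n) set \<Rightarrow> (real ^ 'n) \<Rightarrow> ((real ^ 'n) set \<times> ((real ^ 'n) \<Rightarrow> complex)) set topology" where
  "sector_space P l = toric_variety (quotient_fan (face_fan P) (sector_cone P l))"

section \<open>Orbifold cohomology\<close>

type_synonym 'n toric_class =
  "((((real ^ 'n) set \<times> ((real ^ 'n) \<Rightarrow> complex)) set) chain \<Rightarrow> complex) set"

text \<open>The cohomology of the sector \<open>l\<close> in degree \<open>2a\<close>; it is zero unless \<open>a\<close> is a
  nonnegative integer.\<close>

definition even_cohomology ::
  "(real ^ 'n) set \<Rightarrow> (real ^ 'n) \<Rightarrow> real \<Rightarrow> (complex, 'n toric_class) module" where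
  "even_cohomology P l a =
    (if a \<in> \<nat> then cohomology (2 * nat \<lfloor>a\<rfloor>) (sector_space P l)
     else (cohomology 0 (sector_space P l))\<lparr>carrier := {\<zero>\<^bsub>cohomology 0 (sector_space P l)\<^esub>}\<rparr>)"

definition sector_cohomology ::
  "(real ^ 'n) set \<Rightarrow> (real ^ 'n) \<Rightarrow> (complex, nat \<Rightarrow> 'n toric_class) module" where
  "sector_cohomology P l = family_sum UNIV (\<lambda>j. even_cohomology P l (real j))"

text \<open>The total orbifold cohomology. Only the total space enters below; in its rational
  grading, the component of the sector \<open>l\<close> with index \<open>j\<close> has degree \<open>2 (j + age P l)\<close>.\<close>

definition orb_cohomology ::
  "(real ^ 'n) set \<Rightarrow> (complex, (real ^ 'n) \<Rightarrow> nat \<Rightarrow> 'n toric_class) module" where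
  "orb_cohomology P = family_sum (sectors P) (sector_cohomology P)"

text \<open>The subspace of the orbifold cohomology contributed by a set \<open>A\<close> of sectors.\<close>

definition sectors_part ::
  "(real ^ 'n) set \<Rightarrow> (real ^ 'n) set \<Rightarrow> ((real ^ 'n) \<Rightarrow> nat \<Rightarrow> 'n toric_class) set" where
  "sectors_part P A =
    {x \<in> carrier (orb_cohomology P).
       \<forall>l\<in>sectors P. x l \<noteq> \<zero>\<^bsub>sector_cohomology P l\<^esub> \<longrightarrow> l \<in> A}"

definition orb_cohomology_int ::
  "(real ^ 'n) set \<Rightarrow> ((real ^ 'n) \<Rightarrow> nat \<Rightarrow> 'n toric_class) set" where
  "orb_cohomology_int P = sectors_part P {l. age P l \<in> \<int>}"

definition orb_cohomology_nonint ::
  "(real ^ 'n) set \<Rightarrow> ((real ^ 'n) \<Rightarrow> nat \<Rightarrow> 'n toric_class) set" where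
  "orb_cohomology_nonint P = sectors_part P {l. age P l \<notin> \<int>}"

text \<open>The direct sum of the cohomology groups of degree \<open>2j\<close> of the sector \<open>l\<close>,
  for \<open>j\<close> in \<open>J\<close>, as a subspace of the orbifold cohomology.\<close>

definition sector_degree_part ::
  "(real ^ 'n) set \<Rightarrow> (real ^ 'n) \<Rightarrow> nat set \<Rightarrow> ((real ^ 'n) \<Rightarrow> nat \<Rightarrow> 'n toric_class) set" where
  "sector_degree_part P l J =
    {x \<in> sectors_part P {l}. \<forall>j. x l j \<noteq> \<zero>\<^bsub>even_cohomology P l (real j)\<^esub> \<longrightarrow> j \<in> J}"

section \<open>Filtrations and the mixed Hodge structure\<close>

definition sector_F ::
  "(real ^ 'n) set \<Rightarrow> (real ^ 'n) \<Rightarrow> int \<Rightarrow> (nat \<Rightarrow> 'n toric_class) set" where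
  "sector_F P l p =
    {x \<in> carrier (sector_cohomology P l).
       \<forall>j. x j \<noteq> \<zero>\<^bsub>even_cohomology P l (real j)\<^esub> \<longrightarrow>
         (\<exists>i\<ge>p. real j = (if age P l \<in> \<int> then real CARD('n) - of_int i - age P l
                          else real CARD('n) - 1 - of_int i - of_int \<lfloor>age P l\<rfloor>))}"

definition sector_W ::
  "(real ^ 'n) set \<Rightarrow> (real ^ 'n) \<Rightarrow> int \<Rightarrow> (nat \<Rightarrow> 'n toric_class) set" where
  "sector_W P l m =
    {x \<in> carrier (sector_cohomology P l).
       \<forall>j. x j \<noteq> \<zero>\<^bsub>even_cohomology P l (real j)\<^esub> \<longrightarrow>
         (if age P l \<in> \<int> then int CARD('n) + sector_dim P l - m \<le> 2 * int j
          else int CARD('n) - 1 + sector_dim P l - m \<le> 2 * int j)}"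

definition orb_F ::
  "(real ^ 'n) set \<Rightarrow> int \<Rightarrow> ((real ^ 'n) \<Rightarrow> nat \<Rightarrow> 'n toric_class) set" where
  "orb_F P p = {x \<in> carrier (orb_cohomology P). \<forall>l\<in>sectors P. x l \<in> sector_F P l p}"

definition orb_W ::
  "(real ^ 'n) set \<Rightarrow> int \<Rightarrow> ((real ^ 'n) \<Rightarrow> nat \<Rightarrow> 'n toric_class) set" where
  "orb_W P m = {x \<in> carrier (orb_cohomology P). \<forall>l\<in>sectors P. x l \<in> sector_W P l m}"

definition PL_conjugation ::
  "(real ^ 'n) set \<Rightarrow>
   (((real ^ 'n) \<Rightarrow> nat \<Rightarrow> 'n toric_class) \<Rightarrow> ((real ^ 'n) \<Rightarrow> nat \<Rightarrow> 'n toric_class)) \<Rightarrow> bool" where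
  "PL_conjugation P \<kappa> \<longleftrightarrow>
    (let H = orb_cohomology P in
      \<kappa> \<in> carrier H \<rightarrow> carrier H \<and>
      (\<forall>x\<in>carrier H. \<forall>y\<in>carrier H. \<kappa> (x \<oplus>\<^bsub>H\<^esub> y) = \<kappa> x \<oplus>\<^bsub>H\<^esub> \<kappa> y) \<and>
      (\<forall>a. \<forall>x\<in>carrier H. \<kappa> (a \<odot>\<^bsub>H\<^esub> x) = cnj a \<odot>\<^bsub>H\<^esub> \<kappa> x) \<and>
      (\<forall>x\<in>carrier H. \<kappa> (\<kappa> x) = x) \<and>
      (\<forall>l\<in>sectors P. \<forall>i.
         \<kappa> ` sector_degree_part P l {i} \<subseteq> sector_degree_part P (sector_inv P l) {i..}))"

record 'v hodge_data =
  hd_space :: "(complex, 'v) module"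
  hd_real :: "'v set"
  hd_F :: "int \<Rightarrow> 'v set"
  hd_W :: "int \<Rightarrow> 'v set"

definition MHS_orb ::
  "(real ^ 'n) set \<Rightarrow>
   (((real ^ 'n) \<Rightarrow> nat \<Rightarrow> 'n toric_class) \<Rightarrow> ((real ^ 'n) \<Rightarrow> nat \<Rightarrow> 'n toric_class)) \<Rightarrow>
   ((real ^ 'n) \<Rightarrow> nat \<Rightarrow> 'n toric_class) hodge_data" where
  "MHS_orb P \<kappa> =
    \<lparr>hd_space = orb_cohomology P,
     hd_real = {x \<in> carrier (orb_cohomology P). \<kappa> x = x},
     hd_F = orb_F P,
     hd_W = orb_W P\<rparr>"

definition gr_W :: "(complex, 'v) module \<Rightarrow> (int \<Rightarrow> 'v set) \<Rightarrow> int \<Rightarrow> (complex, 'v set) module" where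
  "gr_W V W m = quotient_space (V\<lparr>carrier := W m\<rparr>) (W (m - 1))"

text \<open>The filtration induced by \<open>F\<close> on the graded piece \<open>gr_W V W m\<close>.\<close>

definition gr_W_F ::
  "(complex, 'v) module \<Rightarrow> (int \<Rightarrow> 'v set) \<Rightarrow> (int \<Rightarrow> 'v set) \<Rightarrow> int \<Rightarrow> int \<Rightarrow> 'v set set" where
  "gr_W_F V F W m p = (\<lambda>x. W (m - 1) +>\<^bsub>V\<^esub> x) ` (F p \<inter> W m)"

definition gr_F_gr_W ::
  "(complex, 'v) module \<Rightarrow> (int \<Rightarrow> 'v set) \<Rightarrow> (int \<Rightarrow> 'v set) \<Rightarrow> int \<Rightarrow> int \<Rightarrow>
   (complex, 'v set set) module" where
  "gr_F_gr_W V F W p m =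
    quotient_space ((gr_W V W m)\<lparr>carrier := gr_W_F V F W m p\<rparr>) (gr_W_F V F W m (p + 1))"

definition hodge_number :: "'v hodge_data \<Rightarrow> int \<Rightarrow> int \<Rightarrow> enat" where
  "hodge_number H p q = vdim (gr_F_gr_W (hd_space H) (hd_F H) (hd_W H) p (p + q))"

text \<open>Restriction to a subspace, with the induced filtrations.\<close>

definition restrict_hodge_data :: "'v hodge_data \<Rightarrow> 'v set \<Rightarrow> 'v hodge_data" where
  "restrict_hodge_data H U =
    \<lparr>hd_space = (hd_space H)\<lparr>carrier := U\<rparr>, hd_real = hd_real H \<inter> U,
     hd_F = (\<lambda>p. hd_F H p \<inter> U), hd_W = (\<lambda>m. hd_W H m \<inter> U)\<rparr>"

end

theory Submission
  imports Defs
begin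

text \<open>
  The orbifold cohomology is the direct sum of the spaces \<open>H\<^bsup>2j\<^esup>(X\<^sub>l)\<close> over finitely many sectors
  \<open>l\<close> and all \<open>j\<close>, and each step of both filtrations is a partial sum of these spaces. The summand
  with index \<open>(l, j)\<close> has one degree for \<open>F\<close> (the largest \<open>p\<close> for which it is one of the summands of
  \<open>F\<^sup>p\<close>) and one weight for \<open>W\<close> (the smallest \<open>m\<close> for which it is one of the summands of \<open>W\<^sub>m\<close>), so
  the bigraded piece for \<open>(p, p + q)\<close> is the direct sum of the summands of degree \<open>p\<close> and weight
  \<open>p + q\<close> (\<open>vdim_gr_F_gr_W_bigraded\<close>). The subspaces of integral and of non-integral age are partial
  sums too, which gives the additivity of the Hodge numbers.

  It remains to solve the two linear equations for \<open>j\<close> and for a condition on \<open>l\<close>. For integral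
  age they read \<open>n - i\<^sub>l - j = p\<close> and \<open>n + n\<^sub>l - 2 j = p + q\<close>. The geometric input is that the
  dimension \<open>n\<^sub>l\<close> of the sector, its age and the age of the inverse sector sum to \<open>n\<close>
  (\<open>age_add_age_sector_inv\<close>); with it, the equations say that \<open>j\<close> is \<open>n\<^sub>l\<close> plus the age of the
  inverse minus \<open>p\<close>, and that the two ages differ by \<open>q - p\<close>. For non-integral age the same holds
  with integer parts, the shift by one in the filtrations compensating for the fractional parts,
  which sum to one. Where the resulting \<open>j\<close> is not a natural number the cohomology is zero.

  Since dimensions may be infinite and spaces are given by cosets, everything is phrased by linear
  surjections with prescribed kernels (\<open>vdim_eq_if_same_kernel\<close>, \<open>vdim_gr_F_gr_W\<close>). The geometry rests
  on one observation: as \<open>0\<close> is an interior point, each ray from \<open>0\<close> meets the proper faces in at most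
  one point (\<open>proper_face_scaling_le_1\<close>). This identifies the rays of a cone with the vertices of
  its face and the smallest cone containing a box element with the cone of its box.
\<close>

section \<open>Complex vector spaces and their dimension\<close>

lemma complex_field_simps [simp]:
  "carrier complex_field = UNIV"
  "a \<otimes>\<^bsub>complex_field\<^esub> b = a * b" "a \<oplus>\<^bsub>complex_field\<^esub> b = a + b"
  "\<one>\<^bsub>complex_field\<^esub> = 1" "\<zero>\<^bsub>complex_field\<^esub> = 0"
  by (simp_all add: complex_field_def)

lemma cring_complex_field: "cring complex_field"
proof (rule cringI)
  have "\<exists>b. b + a = 0" for a :: complex
    by (rule exI[of _ "- a"]) simp
  then show "abelian_group complex_field"
    by (intro abelian_groupI) (auto simp: algebra_simps)
  show "comm_monoid complex_field"
    by (intro comm_monoidI) auto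
qed (auto simp: algebra_simps)

lemma field_complex_field: "field complex_field"
proof (rule cring.cring_fieldI2[OF cring_complex_field])
  fix a assume "a \<in> carrier complex_field" and a: "a \<noteq> \<zero>\<^bsub>complex_field\<^esub>"
  show "\<exists>b\<in>carrier complex_field. a \<otimes>\<^bsub>complex_field\<^esub> b = \<one>\<^bsub>complex_field\<^esub>"
    using a by (intro bexI[of _ "inverse a"]) auto
qed auto

text \<open>The axioms and their first consequences, restated for the concrete field, so that the
  simplifier can use them without the locale and without premises on scalars.\<close>

abbreviation cvs :: "(complex, 'a, 'm) module_scheme \<Rightarrow> bool"
  where "cvs V \<equiv> vectorspace complex_field V"

lemma cvsI:
  assumes "\<zero>\<^bsub>V\<^esub> \<in> carrier V"
    and "\<And>v w. v \<in> carrier V \<Longrightarrow> w \<in> carrier V \<Longrightarrow> v \<oplus>\<^bsub>V\<^esub> w \<in> carrier V"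
    and "\<And>c v. v \<in> carrier V \<Longrightarrow> c \<odot>\<^bsub>V\<^esub> v \<in> carrier V"
    and "\<And>v w. v \<in> carrier V \<Longrightarrow> w \<in> carrier V \<Longrightarrow> v \<oplus>\<^bsub>V\<^esub> w = w \<oplus>\<^bsub>V\<^esub> v"
    and "\<And>u v w. u \<in> carrier V \<Longrightarrow> v \<in> carrier V \<Longrightarrow> w \<in> carrier V \<Longrightarrow>
      (u \<oplus>\<^bsub>V\<^esub> v) \<oplus>\<^bsub>V\<^esub> w = u \<oplus>\<^bsub>V\<^esub> (v \<oplus>\<^bsub>V\<^esub> w)"
    and "\<And>v. v \<in> carrier V \<Longrightarrow> v \<oplus>\<^bsub>V\<^esub> \<zero>\<^bsub>V\<^esub> = v"
    and "\<And>v. v \<in> carrier V \<Longrightarrow> v \<oplus>\<^bsub>V\<^esub> (- 1) \<odot>\<^bsub>V\<^esub> v = \<zero>\<^bsub>V\<^esub>"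
    and "\<And>a b v. v \<in> carrier V \<Longrightarrow> (a * b) \<odot>\<^bsub>V\<^esub> v = a \<odot>\<^bsub>V\<^esub> (b \<odot>\<^bsub>V\<^esub> v)"
    and "\<And>v. v \<in> carrier V \<Longrightarrow> 1 \<odot>\<^bsub>V\<^esub> v = v"
    and "\<And>a b v. v \<in> carrier V \<Longrightarrow> (a + b) \<odot>\<^bsub>V\<^esub> v = a \<odot>\<^bsub>V\<^esub> v \<oplus>\<^bsub>V\<^esub> b \<odot>\<^bsub>V\<^esub> v"
    and "\<And>a v w. v \<in> carrier V \<Longrightarrow> w \<in> carrier V \<Longrightarrow>
      a \<odot>\<^bsub>V\<^esub> (v \<oplus>\<^bsub>V\<^esub> w) = a \<odot>\<^bsub>V\<^esub> v \<oplus>\<^bsub>V\<^esub> a \<odot>\<^bsub>V\<^esub> w"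
  shows "cvs V"
proof -
  have "\<forall>v\<in>carrier V. \<exists>w\<in>carrier V. v \<oplus>\<^bsub>V\<^esub> w = \<zero>\<^bsub>V\<^esub>"
    using assms(3,7) by blast
  then show ?thesis
    by (intro vs_criteria[OF field_complex_field]) (use assms(1-6,8-) in auto)
qed

lemma cvsD:
  assumes "cvs V"
  shows "\<zero>\<^bsub>V\<^esub> \<in> carrier V"
    and "\<And>v w. v \<in> carrier V \<Longrightarrow> w \<in> carrier V \<Longrightarrow> v \<oplus>\<^bsub>V\<^esub> w \<in> carrier V"
    and "\<And>c v. v \<in> carrier V \<Longrightarrow> c \<odot>\<^bsub>V\<^esub> v \<in> carrier V"
    and "\<And>v w. v \<in> carrier V \<Longrightarrow> w \<in> carrier V \<Longrightarrow> v \<oplus>\<^bsub>V\<^esub> w = w \<oplus>\<^bsub>V\<^esub> v"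
    and "\<And>u v w. u \<in> carrier V \<Longrightarrow> v \<in> carrier V \<Longrightarrow> w \<in> carrier V \<Longrightarrow>
      (u \<oplus>\<^bsub>V\<^esub> v) \<oplus>\<^bsub>V\<^esub> w = u \<oplus>\<^bsub>V\<^esub> (v \<oplus>\<^bsub>V\<^esub> w)"
    and "\<And>v. v \<in> carrier V \<Longrightarrow> v \<oplus>\<^bsub>V\<^esub> \<zero>\<^bsub>V\<^esub> = v"
    and "\<And>v. v \<in> carrier V \<Longrightarrow> \<zero>\<^bsub>V\<^esub> \<oplus>\<^bsub>V\<^esub> v = v"
    and "\<And>v. v \<in> carrier V \<Longrightarrow> v \<oplus>\<^bsub>V\<^esub> (- 1) \<odot>\<^bsub>V\<^esub> v = \<zero>\<^bsub>V\<^esub>"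
    and "\<And>a b v. v \<in> carrier V \<Longrightarrow> (a * b) \<odot>\<^bsub>V\<^esub> v = a \<odot>\<^bsub>V\<^esub> (b \<odot>\<^bsub>V\<^esub> v)"
    and "\<And>v. v \<in> carrier V \<Longrightarrow> 1 \<odot>\<^bsub>V\<^esub> v = v"
    and "\<And>a b v. v \<in> carrier V \<Longrightarrow> (a + b) \<odot>\<^bsub>V\<^esub> v = a \<odot>\<^bsub>V\<^esub> v \<oplus>\<^bsub>V\<^esub> b \<odot>\<^bsub>V\<^esub> v"
    and "\<And>a v w. v \<in> carrier V \<Longrightarrow> w \<in> carrier V \<Longrightarrow>
      a \<odot>\<^bsub>V\<^esub> (v \<oplus>\<^bsub>V\<^esub> w) = a \<odot>\<^bsub>V\<^esub> v \<oplus>\<^bsub>V\<^esub> a \<odot>\<^bsub>V\<^esub> w"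
    and "\<And>a. a \<odot>\<^bsub>V\<^esub> \<zero>\<^bsub>V\<^esub> = \<zero>\<^bsub>V\<^esub>"
    and "\<And>v. v \<in> carrier V \<Longrightarrow> 0 \<odot>\<^bsub>V\<^esub> v = \<zero>\<^bsub>V\<^esub>"
proof -
  interpret V: vectorspace complex_field V by fact
  show z: "\<zero>\<^bsub>V\<^esub> \<in> carrier V" by simp
  show ac: "\<And>v w. v \<in> carrier V \<Longrightarrow> w \<in> carrier V \<Longrightarrow> v \<oplus>\<^bsub>V\<^esub> w \<in> carrier V" by simp
  show "\<And>c v. v \<in> carrier V \<Longrightarrow> c \<odot>\<^bsub>V\<^esub> v \<in> carrier V" by simp
  show "\<And>v w. v \<in> carrier V \<Longrightarrow> w \<in> carrier V \<Longrightarrow> v \<oplus>\<^bsub>V\<^esub> w = w \<oplus>\<^bsub>V\<^esub> v"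
    by (simp add: V.a_comm)
  show "\<And>u v w. u \<in> carrier V \<Longrightarrow> v \<in> carrier V \<Longrightarrow> w \<in> carrier V \<Longrightarrow>
      (u \<oplus>\<^bsub>V\<^esub> v) \<oplus>\<^bsub>V\<^esub> w = u \<oplus>\<^bsub>V\<^esub> (v \<oplus>\<^bsub>V\<^esub> w)"
    by (simp add: V.a_assoc)
  show "\<And>v. v \<in> carrier V \<Longrightarrow> v \<oplus>\<^bsub>V\<^esub> \<zero>\<^bsub>V\<^esub> = v" by simp
  show "\<And>v. v \<in> carrier V \<Longrightarrow> \<zero>\<^bsub>V\<^esub> \<oplus>\<^bsub>V\<^esub> v = v" by simp
  show "\<And>a b v. v \<in> carrier V \<Longrightarrow> (a * b) \<odot>\<^bsub>V\<^esub> v = a \<odot>\<^bsub>V\<^esub> (b \<odot>\<^bsub>V\<^esub> v)"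
    using V.smult_assoc1 by simp
  show one: "\<And>v. v \<in> carrier V \<Longrightarrow> 1 \<odot>\<^bsub>V\<^esub> v = v"
    using V.smult_one by simp
  show add: "\<And>a b v. v \<in> carrier V \<Longrightarrow> (a + b) \<odot>\<^bsub>V\<^esub> v = a \<odot>\<^bsub>V\<^esub> v \<oplus>\<^bsub>V\<^esub> b \<odot>\<^bsub>V\<^esub> v"
    using V.smult_l_distr by simp
  show "\<And>a v w. v \<in> carrier V \<Longrightarrow> w \<in> carrier V \<Longrightarrow>
      a \<odot>\<^bsub>V\<^esub> (v \<oplus>\<^bsub>V\<^esub> w) = a \<odot>\<^bsub>V\<^esub> v \<oplus>\<^bsub>V\<^esub> a \<odot>\<^bsub>V\<^esub> w"
    using V.smult_r_distr by simp
  show "\<And>a. a \<odot>\<^bsub>V\<^esub> \<zero>\<^bsub>V\<^esub> = \<zero>\<^bsub>V\<^esub>" using V.smult_r_null by simp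
  show nul: "\<And>v. v \<in> carrier V \<Longrightarrow> 0 \<odot>\<^bsub>V\<^esub> v = \<zero>\<^bsub>V\<^esub>" using V.smult_l_null by simp
  show "v \<oplus>\<^bsub>V\<^esub> (- 1) \<odot>\<^bsub>V\<^esub> v = \<zero>\<^bsub>V\<^esub>" if "v \<in> carrier V" for v
    using add[of v 1 "-1"] that by (simp add: one nul)
qed

text \<open>The closure conditions of \<open>submodule\<close> alone, without the module axioms for \<open>V\<close>.\<close>

definition lin_subspace :: "(complex, 'a, 'm) module_scheme \<Rightarrow> 'a set \<Rightarrow> bool" where
  "lin_subspace V U \<longleftrightarrow> U \<subseteq> carrier V \<and> \<zero>\<^bsub>V\<^esub> \<in> U \<and> (\<forall>x\<in>U. \<forall>y\<in>U. x \<oplus>\<^bsub>V\<^esub> y \<in> U) \<and>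
     (\<forall>c. \<forall>x\<in>U. c \<odot>\<^bsub>V\<^esub> x \<in> U)"

lemma cvs_subspace:
  assumes "cvs V" "lin_subspace V U"
  shows "cvs (V\<lparr>carrier := U\<rparr>)"
  using assms(2) cvsD[OF assms(1)] unfolding lin_subspace_def
  by (intro cvsI) (auto simp: subset_iff)

lemma lin_subspace_submodule:
  assumes "cvs V" "lin_subspace V U"
  shows "submodule complex_field U V"
  using assms unfolding lin_subspace_def submodule_def vectorspace_def by auto

abbreviation lin :: "(complex, 'a, 'm) module_scheme \<Rightarrow> (complex, 'b, 'l) module_scheme \<Rightarrow> ('a \<Rightarrow> 'b) set"
  where "lin V W \<equiv> module_hom complex_field V W"

lemma linI:
  assumes "\<And>x. x \<in> carrier V \<Longrightarrow> f x \<in> carrier W"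
    and "\<And>x y. x \<in> carrier V \<Longrightarrow> y \<in> carrier V \<Longrightarrow> f (x \<oplus>\<^bsub>V\<^esub> y) = f x \<oplus>\<^bsub>W\<^esub> f y"
    and "\<And>c x. x \<in> carrier V \<Longrightarrow> f (c \<odot>\<^bsub>V\<^esub> x) = c \<odot>\<^bsub>W\<^esub> f x"
  shows "f \<in> lin V W"
  using assms unfolding module_hom_def by auto

lemma linD:
  assumes "f \<in> lin V W"
  shows "\<And>x. x \<in> carrier V \<Longrightarrow> f x \<in> carrier W"
    and "\<And>x y. x \<in> carrier V \<Longrightarrow> y \<in> carrier V \<Longrightarrow> f (x \<oplus>\<^bsub>V\<^esub> y) = f x \<oplus>\<^bsub>W\<^esub> f y"
    and "\<And>c x. x \<in> carrier V \<Longrightarrow> f (c \<odot>\<^bsub>V\<^esub> x) = c \<odot>\<^bsub>W\<^esub> f x"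
  using assms unfolding module_hom_def by auto

lemma lin_zero:
  assumes "cvs V" "cvs W" "f \<in> lin V W"
  shows "f \<zero>\<^bsub>V\<^esub> = \<zero>\<^bsub>W\<^esub>"
  by (metis assms cvsD(1,14) linD(1,3))

lemma linear_mapI:
  assumes "cvs V" "cvs W" "f \<in> lin V W"
  shows "linear_map complex_field V W f"
  using assms unfolding linear_map_def mod_hom_def mod_hom_axioms_def vectorspace_def by auto

lemma lin_image:
  assumes "cvs V" "cvs W" "f \<in> lin V W" "lin_subspace V U"
  shows "lin_subspace W (f ` U)"
  unfolding lin_subspace_def
proof (intro conjI ballI allI)
  note U = assms(4)[unfolded lin_subspace_def]
  show "f ` U \<subseteq> carrier W" using U linD[OF assms(3)] by auto
  show "\<zero>\<^bsub>W\<^esub> \<in> f ` U" using U lin_zero[OF assms(1-3)] by (metis imageI)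
  show "x \<oplus>\<^bsub>W\<^esub> y \<in> f ` U" if "x \<in> f ` U" "y \<in> f ` U" for x y
    using that U linD(2)[OF assms(3), symmetric] by (auto simp: subset_iff)
  show "c \<odot>\<^bsub>W\<^esub> x \<in> f ` U" if "x \<in> f ` U" for x c
    using that U linD(3)[OF assms(3), symmetric] by (auto simp: subset_iff)
qed

lemma lin_diff_eq:
  assumes "cvs V" "cvs W" "f \<in> lin V W" "x \<in> carrier V" "y \<in> carrier V"
  shows "f x = f y \<longleftrightarrow> f (x \<oplus>\<^bsub>V\<^esub> (- 1) \<odot>\<^bsub>V\<^esub> y) = \<zero>\<^bsub>W\<^esub>"
proof -
  note V = cvsD[OF assms(1)] and W = cvsD[OF assms(2)] and f = linD[OF assms(3)]
  have e: "f (x \<oplus>\<^bsub>V\<^esub> (- 1) \<odot>\<^bsub>V\<^esub> y) = f x \<oplus>\<^bsub>W\<^esub> (- 1) \<odot>\<^bsub>W\<^esub> f y"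
    using assms(4,5) V f by simp
  have "f x = f y" if "f x \<oplus>\<^bsub>W\<^esub> (- 1) \<odot>\<^bsub>W\<^esub> f y = \<zero>\<^bsub>W\<^esub>"
  proof -
    have "f x = f x \<oplus>\<^bsub>W\<^esub> ((- 1) \<odot>\<^bsub>W\<^esub> f y \<oplus>\<^bsub>W\<^esub> f y)"
      using assms(4,5) f W by (metis)
    also have "\<dots> = (f x \<oplus>\<^bsub>W\<^esub> (- 1) \<odot>\<^bsub>W\<^esub> f y) \<oplus>\<^bsub>W\<^esub> f y"
      using assms(4,5) f W by metis
    finally show ?thesis using that assms(4,5) f W by simp
  qed
  then show ?thesis using e W f assms(4,5) by metis
qed

lemma vdim_eq_0:
  assumes "cvs V" "carrier V = {\<zero>\<^bsub>V\<^esub>}"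
  shows "vdim V = 0"
proof -
  interpret V: vectorspace complex_field V by fact
  have "V.span {} = carrier V"
    unfolding V.span_empty assms(2) ..
  then have "V.fin_dim" "V.dim = 0"
    using V.gen_ge_dim[of "{}"] by (auto simp: V.fin_dim_def)
  then show ?thesis by (simp add: vdim_def zero_enat_def)
qed

lemma vdim_eq_if_bij:
  assumes "cvs V" "cvs W" "f \<in> lin V W" "bij_betw f (carrier V) (carrier W)"
  shows "vdim V = vdim W"
proof -
  let ?g = "inv_into (carrier V) f"
  have inj: "inj_on f (carrier V)" and im: "f ` carrier V = carrier W"
    using assms(4) by (auto simp: bij_betw_def)
  have g: "\<And>y. y \<in> carrier W \<Longrightarrow> ?g y \<in> carrier V \<and> f (?g y) = y"
    using im inv_into_into f_inv_into_f by metis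
  note V = cvsD[OF assms(1)] and W = cvsD[OF assms(2)] and fl = linD[OF assms(3)]
  have gl: "?g \<in> lin W V"
  proof (rule linI)
    fix x y assume xy: "x \<in> carrier W" "y \<in> carrier W"
    have "f (?g x \<oplus>\<^bsub>V\<^esub> ?g y) = x \<oplus>\<^bsub>W\<^esub> y" using g xy fl by simp
    then show "?g (x \<oplus>\<^bsub>W\<^esub> y) = ?g x \<oplus>\<^bsub>V\<^esub> ?g y"
      using inv_into_f_f[OF inj] V(2) g xy by metis
  next
    fix c x assume x: "x \<in> carrier W"
    have "f (c \<odot>\<^bsub>V\<^esub> ?g x) = c \<odot>\<^bsub>W\<^esub> x" using g x fl by simp
    then show "?g (c \<odot>\<^bsub>W\<^esub> x) = c \<odot>\<^bsub>V\<^esub> ?g x"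
      using inv_into_f_f[OF inj] V(3) g x by metis
  qed (use g in auto)
  interpret L: linear_map complex_field V W f using linear_mapI assms by blast
  interpret G: linear_map complex_field W V ?g using linear_mapI assms gl by blast
  have gim: "?g ` carrier W = carrier V"
    using inj im by (metis inv_into_image_cancel subset_refl)
  have "L.V.fin_dim \<longleftrightarrow> L.W.fin_dim"
    using L.surj_fin_dim im G.surj_fin_dim gim by blast
  moreover have "L.V.dim = L.W.dim" if "L.V.fin_dim" using L.dim_eq[OF that inj im] .
  ultimately show ?thesis unfolding vdim_def by simp
qed

text \<open>Two quotients of the same space by the same subspace have the same dimension, finite or
  not: sending \<open>f x\<close> to \<open>g x\<close> is a well-defined bijection. This is how dimensions of
  spaces of cosets are computed below without ever choosing bases.\<close>

lemma vdim_eq_if_same_kernel: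
  assumes X: "cvs X" and A: "cvs A" and B: "cvs B"
    and f: "f \<in> lin X A" "f ` carrier X = carrier A"
    and g: "g \<in> lin X B" "g ` carrier X = carrier B"
    and ker: "\<And>x. x \<in> carrier X \<Longrightarrow> f x = \<zero>\<^bsub>A\<^esub> \<longleftrightarrow> g x = \<zero>\<^bsub>B\<^esub>"
  shows "vdim A = vdim B"
proof -
  note Xd = cvsD[OF X]
  have eq: "f x = f y \<longleftrightarrow> g x = g y" if "x \<in> carrier X" "y \<in> carrier X" for x y
    using lin_diff_eq[OF X A f(1) that] lin_diff_eq[OF X B g(1) that] ker Xd that by simp
  let ?s = "inv_into (carrier X) f"
  define h where "h a = g (?s a)" for a
  have hf: "h (f x) = g x" if "x \<in> carrier X" for x
    using eq that inv_into_into[of "f x" f "carrier X"] f_inv_into_f[of "f x" f "carrier X"]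
    unfolding h_def by blast
  have cA: "\<exists>x\<in>carrier X. a = f x" if "a \<in> carrier A" for a using f(2) that by auto
  have hl: "h \<in> lin A B"
  proof (rule linI)
    fix a assume "a \<in> carrier A" then show "h a \<in> carrier B"
      using cA[of a] hf linD(1)[OF g(1)] by force
  next
    fix a b assume "a \<in> carrier A" "b \<in> carrier A"
    then obtain x y where xy: "x \<in> carrier X" "y \<in> carrier X" "a = f x" "b = f y" using cA by meson
    then show "h (a \<oplus>\<^bsub>A\<^esub> b) = h a \<oplus>\<^bsub>B\<^esub> h b"
      using hf Xd(2)[of x y] linD(2)[OF g(1)] linD(2)[OF f(1), symmetric] by simp
  next
    fix c a assume "a \<in> carrier A"
    then obtain x where xy: "x \<in> carrier X" "a = f x" using cA by meson
    then show "h (c \<odot>\<^bsub>A\<^esub> a) = c \<odot>\<^bsub>B\<^esub> h a"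
      using hf Xd(3)[of x c] linD(3)[OF g(1)] linD(3)[OF f(1), symmetric] by simp
  qed
  have "bij_betw h (carrier A) (carrier B)"
    unfolding bij_betw_def
  proof
    show "inj_on h (carrier A)"
    proof (rule inj_onI)
      fix a b assume "a \<in> carrier A" "b \<in> carrier A" and h: "h a = h b"
      then obtain x y where xy: "x \<in> carrier X" "y \<in> carrier X" "a = f x" "b = f y"
        using cA by meson
      with h have "g x = g y" using hf by simp
      then show "a = b" using eq xy by simp
    qed
    have "h ` carrier A = (\<lambda>x. h (f x)) ` carrier X" unfolding f(2)[symmetric] image_image ..
    also have "\<dots> = carrier B" unfolding g(2)[symmetric] using hf by (intro image_cong) auto
    finally show "h ` carrier A = carrier B" .
  qed
  then show ?thesis by (rule vdim_eq_if_bij[OF A B hl])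
qed

text \<open>The images of two generating sets generate: the vectors of either summand whose image lies
  in their span form a subspace that contains the generating set.\<close>

lemma fin_dim_direct_sum:
  assumes V: "cvs V" and W: "cvs W"
    and "vectorspace.fin_dim complex_field V" "vectorspace.fin_dim complex_field W"
  shows "vectorspace.fin_dim complex_field (direct_sum V W)"
proof -
  have D: "cvs (direct_sum V W)" using V W by (rule direct_sum_is_vs)
  interpret V: vectorspace complex_field V by fact
  interpret W: vectorspace complex_field W by fact
  interpret D: vectorspace complex_field "direct_sum V W" by fact
  obtain S where S: "finite S" "S \<subseteq> carrier V" "V.span S = carrier V"
    using assms(3) V.fin_dim_def by auto
  obtain T where T: "finite T" "T \<subseteq> carrier W" "W.span T = carrier W"
    using assms(4) W.fin_dim_def by auto
  note Vd = cvsD[OF V] and Wd = cvsD[OF W]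
  let ?G = "(\<lambda>v. (v, \<zero>\<^bsub>W\<^esub>)) ` S \<union> (\<lambda>w. (\<zero>\<^bsub>V\<^esub>, w)) ` T"
  have G: "?G \<subseteq> carrier (direct_sum V W)"
    using S T Vd Wd by (auto simp: direct_sum_def)
  have sub: "submodule complex_field (D.span ?G) (direct_sum V W)"
    using D.span_is_submodule G by blast
  note sp = submodule.m_closed[OF sub] submodule.smult_closed[OF sub] submodule.zero_closed[OF sub]
  have mem: "x \<in> D.span ?G" if "x \<in> ?G" for x using D.span_mem G that by blast
  have subV: "submodule complex_field {v \<in> carrier V. (v, \<zero>\<^bsub>W\<^esub>) \<in> D.span ?G} V"
    by (rule lin_subspace_submodule[OF V], unfold lin_subspace_def)
      (use Vd Wd sp(1)[of "(_, \<zero>\<^bsub>W\<^esub>)" "(_, \<zero>\<^bsub>W\<^esub>)"] sp(2)[of _ "(_, \<zero>\<^bsub>W\<^esub>)"] sp(3) in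
        \<open>auto simp: direct_sum_def\<close>)
  have subW: "submodule complex_field {w \<in> carrier W. (\<zero>\<^bsub>V\<^esub>, w) \<in> D.span ?G} W"
    by (rule lin_subspace_submodule[OF W], unfold lin_subspace_def)
      (use Vd Wd sp(1)[of "(\<zero>\<^bsub>V\<^esub>, _)" "(\<zero>\<^bsub>V\<^esub>, _)"] sp(2)[of _ "(\<zero>\<^bsub>V\<^esub>, _)"] sp(3) in
        \<open>auto simp: direct_sum_def\<close>)
  have allV: "(v, \<zero>\<^bsub>W\<^esub>) \<in> D.span ?G" if "v \<in> carrier V" for v
  proof -
    have "S \<subseteq> {v \<in> carrier V. (v, \<zero>\<^bsub>W\<^esub>) \<in> D.span ?G}" using S(2) mem by blast
    from V.span_is_subset[OF this subV] show ?thesis using S(3) that by blast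
  qed
  have allW: "(\<zero>\<^bsub>V\<^esub>, w) \<in> D.span ?G" if "w \<in> carrier W" for w
  proof -
    have "T \<subseteq> {w \<in> carrier W. (\<zero>\<^bsub>V\<^esub>, w) \<in> D.span ?G}" using T(2) mem by blast
    from W.span_is_subset[OF this subW] show ?thesis using T(3) that by blast
  qed
  have "(v, w) \<in> D.span ?G" if "v \<in> carrier V" "w \<in> carrier W" for v w
    using sp(1)[OF allV[OF that(1)] allW[OF that(2)]] that Vd Wd by (simp add: direct_sum_def)
  then have "carrier (direct_sum V W) \<subseteq> D.span ?G" by (auto simp: direct_sum_def)
  then have "D.span ?G = carrier (direct_sum V W)"
    using submodule.subset[OF sub] by blast
  moreover have "finite ?G" using S(1) T(1) by simp
  ultimately show ?thesis unfolding D.fin_dim_def using G by (intro exI[of _ ?G] conjI)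
qed

text \<open>If both summands are finite-dimensional this is rank-nullity for the second projection, whose
  kernel is a copy of \<open>V\<close>. Otherwise the sum is infinite-dimensional as well, because each
  summand is an image of it.\<close>

lemma vdim_direct_sum:
  assumes V: "cvs V" and W: "cvs W"
  shows "vdim (direct_sum V W) = vdim V + vdim W"
proof -
  let ?D = "direct_sum V W"
  have D: "cvs ?D" using V W by (rule direct_sum_is_vs)
  note Vd = cvsD[OF V] and Wd = cvsD[OF W]
  have sndl: "snd \<in> lin ?D W" and fstl: "fst \<in> lin ?D V"
    by (auto intro!: linI simp: direct_sum_def)
  interpret V: vectorspace complex_field V by fact
  interpret W: vectorspace complex_field W by fact
  interpret D: vectorspace complex_field ?D by fact
  interpret Q: linear_map complex_field ?D W snd using linear_mapI[OF D W sndl] .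
  interpret P: linear_map complex_field ?D V fst using linear_mapI[OF D V fstl] .
  have ims: "snd ` carrier ?D = carrier W" and imf: "fst ` carrier ?D = carrier V"
    using Vd(1) Wd(1) by (force simp: direct_sum_def)+
  show ?thesis
  proof (cases "V.fin_dim \<and> W.fin_dim")
    case True
    then have fd: "D.fin_dim" using fin_dim_direct_sum V W by blast
    let ?K = "?D\<lparr>carrier := Q.kerT\<rparr>"
    have K: "Q.kerT = carrier V \<times> {\<zero>\<^bsub>W\<^esub>}"
      unfolding Q.ker_def using Wd(1) by (auto simp: direct_sum_def)
    have kvs: "cvs ?K" using D.subspace_is_vs Q.kerT_is_subspace by blast
    have jl: "(\<lambda>v. (v, \<zero>\<^bsub>W\<^esub>)) \<in> lin V ?K"
      using Vd Wd by (intro linI) (auto simp: K, auto simp: direct_sum_def)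
    have "bij_betw (\<lambda>v. (v, \<zero>\<^bsub>W\<^esub>)) (carrier V) (carrier ?K)"
      by (auto simp: bij_betw_def inj_on_def K)
    then have "vdim V = vdim ?K" using vdim_eq_if_bij[OF V kvs jl] by blast
    then have "vectorspace.dim complex_field ?K = V.dim"
      using True by (auto simp: vdim_def split: if_splits)
    moreover have "W\<lparr>carrier := Q.imT\<rparr> = W" using ims by (simp add: Q.im_def)
    ultimately have "D.dim = V.dim + W.dim"
      using Q.rank_nullity[OF fd] by simp
    then show ?thesis using True fd by (simp add: vdim_def)
  next
    case False
    then have "\<not> D.fin_dim"
      using P.surj_fin_dim[OF _ imf] Q.surj_fin_dim[OF _ ims] by blast
    then show ?thesis using False by (auto simp: vdim_def)
  qed
qed

section \<open>Quotient spaces\<close>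

lemma lin_subspace_abelian_subgroup:
  assumes "cvs V" "lin_subspace V U"
  shows "abelian_subgroup U V"
proof (rule abelian_subgroupI3)
  interpret V: vectorspace complex_field V by fact
  note U = assms(2)[unfolded lin_subspace_def]
  show "abelian_group V" ..
  show "additive_subgroup U V"
  proof (rule additive_subgroupI, rule subgroup.intro)
    fix x assume "x \<in> U"
    then have x: "x \<in> carrier V" "(- 1) \<odot>\<^bsub>V\<^esub> x \<in> U" using U by auto
    have "inv\<^bsub>add_monoid V\<^esub> x = \<ominus>\<^bsub>V\<^esub> x" by (simp add: a_inv_def)
    also have "\<dots> = (- 1) \<odot>\<^bsub>V\<^esub> x"
      using x cvsD(3,4,8)[OF assms(1)] by (intro V.minus_equality) auto
    finally show "inv\<^bsub>add_monoid V\<^esub> x \<in> U" using x by simp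
  qed (use U in auto)
qed

lemma quotient_space_sel:
  "carrier (quotient_space V U) = (\<lambda>x. U +>\<^bsub>V\<^esub> x) ` carrier V"
  "\<zero>\<^bsub>quotient_space V U\<^esub> = U"
  by (auto simp: quotient_space_def A_RCOSETS_def')

text \<open>Addition and scaling of cosets are defined on all representatives at once; they are
  computed by any one of them.\<close>

lemma quotient_space_ops:
  assumes V: "cvs V" and U: "lin_subspace V U" and x: "x \<in> carrier V"
  shows "y \<in> carrier V \<Longrightarrow>
      (U +>\<^bsub>V\<^esub> x) \<oplus>\<^bsub>quotient_space V U\<^esub> (U +>\<^bsub>V\<^esub> y) = U +>\<^bsub>V\<^esub> (x \<oplus>\<^bsub>V\<^esub> y)"
    and "c \<odot>\<^bsub>quotient_space V U\<^esub> (U +>\<^bsub>V\<^esub> x) = U +>\<^bsub>V\<^esub> (c \<odot>\<^bsub>V\<^esub> x)"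
proof -
  interpret S: abelian_subgroup U V using lin_subspace_abelian_subgroup[OF V U] .
  note Vd = cvsD[OF V] and Ud = U[unfolded lin_subspace_def]
  show "(U +>\<^bsub>V\<^esub> x) \<oplus>\<^bsub>quotient_space V U\<^esub> (U +>\<^bsub>V\<^esub> y) = U +>\<^bsub>V\<^esub> (x \<oplus>\<^bsub>V\<^esub> y)"
    if "y \<in> carrier V"
    using S.a_rcos_sum[OF x that] by (simp add: quotient_space_def)
  have "U +>\<^bsub>V\<^esub> (c \<odot>\<^bsub>V\<^esub> z) = U +>\<^bsub>V\<^esub> (c \<odot>\<^bsub>V\<^esub> x)" if z: "z \<in> U +>\<^bsub>V\<^esub> x" for z
  proof -
    obtain u where u: "u \<in> U" "z = u \<oplus>\<^bsub>V\<^esub> x" using z by (auto simp: a_r_coset_def')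
    then have uV: "u \<in> carrier V" using Ud by auto
    have "c \<odot>\<^bsub>V\<^esub> z = c \<odot>\<^bsub>V\<^esub> u \<oplus>\<^bsub>V\<^esub> c \<odot>\<^bsub>V\<^esub> x" using u uV x Vd(12) by simp
    moreover have "c \<odot>\<^bsub>V\<^esub> u \<in> U" using u Ud by auto
    ultimately have "c \<odot>\<^bsub>V\<^esub> z \<in> U +>\<^bsub>V\<^esub> (c \<odot>\<^bsub>V\<^esub> x)" by (auto simp: a_r_coset_def')
    then show ?thesis
      using S.a_repr_independence[of "c \<odot>\<^bsub>V\<^esub> z" U "c \<odot>\<^bsub>V\<^esub> x"] Vd(3)[OF x] S.a_subgroup by simp
  qed
  then have "(\<Union>z\<in>U +>\<^bsub>V\<^esub> x. U +>\<^bsub>V\<^esub> (c \<odot>\<^bsub>V\<^esub> z)) =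
      (\<Union>z\<in>U +>\<^bsub>V\<^esub> x. U +>\<^bsub>V\<^esub> (c \<odot>\<^bsub>V\<^esub> x))"
    by (intro SUP_cong refl)
  also have "\<dots> = U +>\<^bsub>V\<^esub> (c \<odot>\<^bsub>V\<^esub> x)"
    using S.a_rcos_self[OF x] by auto
  finally show "c \<odot>\<^bsub>quotient_space V U\<^esub> (U +>\<^bsub>V\<^esub> x) = U +>\<^bsub>V\<^esub> (c \<odot>\<^bsub>V\<^esub> x)"
    by (simp add: quotient_space_def)
qed

lemma quotient_map_lin:
  assumes V: "cvs V" and U: "lin_subspace V U"
  shows "(\<lambda>x. U +>\<^bsub>V\<^esub> x) \<in> lin V (quotient_space V U)"
  using quotient_space_ops[OF assms] by (intro linI) (auto simp: quotient_space_sel)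

lemma quotient_map_eq_zero_iff:
  assumes V: "cvs V" and U: "lin_subspace V U" and x: "x \<in> carrier V"
  shows "U +>\<^bsub>V\<^esub> x = \<zero>\<^bsub>quotient_space V U\<^esub> \<longleftrightarrow> x \<in> U"
proof -
  interpret S: abelian_subgroup U V using lin_subspace_abelian_subgroup[OF V U] .
  show ?thesis using S.a_rcos_self[OF x] S.a_rcos_const[of x] by (auto simp: quotient_space_sel)
qed

lemma cvs_quotient_space:
  assumes V: "cvs V" and U: "lin_subspace V U"
  shows "cvs (quotient_space V U)"
proof -
  note Vd = cvsD[OF V] and ops = quotient_space_ops[OF V U]
  have z: "\<zero>\<^bsub>quotient_space V U\<^esub> = U +>\<^bsub>V\<^esub> \<zero>\<^bsub>V\<^esub>"
    using quotient_map_eq_zero_iff[OF V U, of "\<zero>\<^bsub>V\<^esub>"] Vd(1) U by (simp add: lin_subspace_def)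
  have comm: "U +>\<^bsub>V\<^esub> (x \<oplus>\<^bsub>V\<^esub> y) = U +>\<^bsub>V\<^esub> (y \<oplus>\<^bsub>V\<^esub> x)"
    if "x \<in> carrier V" "y \<in> carrier V" for x y
    using Vd(4)[OF that] by simp
  show ?thesis
    by (rule cvsI, unfold z quotient_space_sel(1))
      (auto simp: ops Vd(1-3,5-) comm)
qed

section \<open>Graded pieces of two filtrations\<close>

lemma a_r_coset_carrier_update [simp]: "U +>\<^bsub>V\<lparr>carrier := W\<rparr>\<^esub> x = U +>\<^bsub>V\<^esub> x"
  by (simp add: a_r_coset_def')

text \<open>Cosets do not depend on the carrier, so the graded pieces of a subspace are determined by its
  induced filtrations alone.\<close>

lemma gr_F_gr_W_carrier_update:
  "gr_F_gr_W (V\<lparr>carrier := U\<rparr>) F W p m = gr_F_gr_W V F W p m"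
  by (simp add: gr_F_gr_W_def gr_W_def gr_W_F_def)

lemma lin_subspace_restrict:
  assumes "lin_subspace V U" "U \<subseteq> W"
  shows "lin_subspace (V\<lparr>carrier := W\<rparr>) U"
  using assms unfolding lin_subspace_def by auto

lemma lin_subspace_Int:
  assumes "lin_subspace V U" "lin_subspace V W"
  shows "lin_subspace V (U \<inter> W)"
  using assms unfolding lin_subspace_def by auto

lemma lin_restrict:
  assumes "f \<in> lin V W" "A \<subseteq> carrier V" "f ` A \<subseteq> B"
  shows "f \<in> lin (V\<lparr>carrier := A\<rparr>) (W\<lparr>carrier := B\<rparr>)"
  using assms(2,3) linD[OF assms(1)] by (intro linI) (auto simp: subset_iff)

text \<open>The iterated graded piece is the quotient of \<open>F p \<inter> W m\<close> by
  \<open>F (p + 1) \<inter> W m + F p \<inter> W (m - 1)\<close>: passing to cosets modulo \<open>W (m - 1)\<close> and then to cosets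
  of those is a surjection with this kernel. So any linear surjection from \<open>F p \<inter> W m\<close> with
  the same kernel computes the dimension. In the kernel condition the summand \<open>z\<close> lies in \<open>F p\<close>
  automatically, because \<open>x\<close> and \<open>y\<close> do.\<close>

lemma vdim_gr_F_gr_W:
  fixes V :: "(complex, 'a) module" and B :: "(complex, 'b) module"
  assumes V: "cvs V" and B: "cvs B"
    and F: "\<And>p. lin_subspace V (F p)" "F (p + 1) \<subseteq> F p"
    and W: "\<And>m. lin_subspace V (W m)" "W (m - 1) \<subseteq> W m"
    and g: "g \<in> lin (V\<lparr>carrier := F p \<inter> W m\<rparr>) B" "g ` (F p \<inter> W m) = carrier B"
    and ker: "\<And>x. x \<in> F p \<inter> W m \<Longrightarrow>
      g x = \<zero>\<^bsub>B\<^esub> \<longleftrightarrow> (\<exists>y\<in>F (p + 1) \<inter> W m. \<exists>z\<in>W (m - 1). x = z \<oplus>\<^bsub>V\<^esub> y)"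
  shows "vdim (gr_F_gr_W V F W p m) = vdim B"
proof -
  define X where "X = V\<lparr>carrier := F p \<inter> W m\<rparr>"
  define G where "G = gr_W V W m"
  define G' where "G' p' = gr_W_F V F W m p'" for p'
  let ?r = "\<lambda>x. W (m - 1) +>\<^bsub>V\<^esub> x"
  have Wm: "cvs (V\<lparr>carrier := W m\<rparr>)" using cvs_subspace[OF V W(1)] .
  have Ws: "lin_subspace (V\<lparr>carrier := W m\<rparr>) (W (m - 1))"
    using lin_subspace_restrict W by blast
  have G: "cvs G" unfolding G_def gr_W_def by (rule cvs_quotient_space[OF Wm Ws])
  have r: "?r \<in> lin (V\<lparr>carrier := W m\<rparr>) G"
    using quotient_map_lin[OF Wm Ws] unfolding G_def gr_W_def by simp
  have rker: "?r x = \<zero>\<^bsub>G\<^esub> \<longleftrightarrow> x \<in> W (m - 1)" if "x \<in> W m" for x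
    using quotient_map_eq_zero_iff[OF Wm Ws] that unfolding G_def gr_W_def by simp
  have G's: "lin_subspace G (G' p')" for p'
    unfolding G'_def gr_W_F_def
    by (rule lin_image[OF Wm G r])
      (rule lin_subspace_restrict[OF lin_subspace_Int[OF F(1) W(1)]], blast)
  have G'mono: "G' (p + 1) \<subseteq> G' p" unfolding G'_def gr_W_F_def using F(2) by blast
  have Gp: "cvs (G\<lparr>carrier := G' p\<rparr>)" using cvs_subspace[OF G G's] .
  have Gs: "lin_subspace (G\<lparr>carrier := G' p\<rparr>) (G' (p + 1))"
    using lin_subspace_restrict[OF G's G'mono] .
  let ?Q = "gr_F_gr_W V F W p m"
  have Q_def: "?Q = quotient_space (G\<lparr>carrier := G' p\<rparr>) (G' (p + 1))"
    unfolding gr_F_gr_W_def G_def G'_def ..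
  have Q: "cvs ?Q" unfolding Q_def by (rule cvs_quotient_space[OF Gp Gs])
  let ?s = "\<lambda>y. G' (p + 1) +>\<^bsub>G\<^esub> y"
  have s: "?s \<in> lin (G\<lparr>carrier := G' p\<rparr>) ?Q"
    using quotient_map_lin[OF Gp Gs] unfolding Q_def by simp
  have sker: "?s y = \<zero>\<^bsub>?Q\<^esub> \<longleftrightarrow> y \<in> G' (p + 1)" if "y \<in> G' p" for y
    using quotient_map_eq_zero_iff[OF Gp Gs] that unfolding Q_def by simp
  have X: "cvs X" unfolding X_def by (rule cvs_subspace[OF V lin_subspace_Int[OF F(1) W(1)]])
  have rX: "?r ` carrier X = G' p" unfolding X_def G'_def gr_W_F_def by simp
  have rl: "?r \<in> lin X (G\<lparr>carrier := G' p\<rparr>)"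
    using lin_restrict[OF r, of "F p \<inter> W m" "G' p"] rX unfolding X_def by auto
  have "(\<lambda>x. ?s (?r x)) \<in> lin X ?Q"
    using linD[OF rl] linD[OF s] by (intro linI) auto
  moreover have "(\<lambda>x. ?s (?r x)) ` carrier X = carrier ?Q"
    unfolding Q_def quotient_space_sel(1) using rX by (auto simp: image_image[symmetric])
  moreover have "?s (?r x) = \<zero>\<^bsub>?Q\<^esub> \<longleftrightarrow> g x = \<zero>\<^bsub>B\<^esub>" if x: "x \<in> carrier X" for x
  proof -
    have xx: "x \<in> F p \<inter> W m" using x by (simp add: X_def)
    note Vd = cvsD[OF V]
    have Wc: "W m \<subseteq> carrier V" using W(1) by (simp add: lin_subspace_def)
    have "?s (?r x) = \<zero>\<^bsub>?Q\<^esub> \<longleftrightarrow> ?r x \<in> G' (p + 1)" using sker rX x by blast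
    also have "\<dots> \<longleftrightarrow> (\<exists>y\<in>F (p + 1) \<inter> W m. ?r x = ?r y)" by (auto simp: G'_def gr_W_F_def)
    also have "\<dots> \<longleftrightarrow> (\<exists>y\<in>F (p + 1) \<inter> W m. \<exists>z\<in>W (m - 1). x = z \<oplus>\<^bsub>V\<^esub> y)"
    proof (intro bex_cong refl)
      fix y assume "y \<in> F (p + 1) \<inter> W m"
      then have y: "y \<in> W m" by simp
      interpret S: abelian_subgroup "W (m - 1)" V
        using lin_subspace_abelian_subgroup[OF V W(1)] .
      have c: "x \<in> carrier V" "y \<in> carrier V" using xx y Wc by auto
      have "?r x = ?r y \<longleftrightarrow> x \<in> ?r y"
        using S.a_repr_independence[of x "W (m - 1)" y] S.a_rcos_self c S.a_subgroup by metis
      also have "\<dots> \<longleftrightarrow> (\<exists>z\<in>W (m - 1). x = z \<oplus>\<^bsub>V\<^esub> y)" by (auto simp: a_r_coset_def')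
      finally show "?r x = ?r y \<longleftrightarrow> (\<exists>z\<in>W (m - 1). x = z \<oplus>\<^bsub>V\<^esub> y)" .
    qed
    finally show ?thesis using ker[OF xx] by simp
  qed
  ultimately show ?thesis
    using vdim_eq_if_same_kernel[OF X Q B, of "\<lambda>x. ?s (?r x)" g] g unfolding X_def by simp
qed

section \<open>Direct sums of families\<close>

lemma family_sum_sel [simp]:
  "\<zero>\<^bsub>family_sum I V\<^esub> = (\<lambda>i\<in>I. \<zero>\<^bsub>V i\<^esub>)"
  "x \<oplus>\<^bsub>family_sum I V\<^esub> y = (\<lambda>i\<in>I. x i \<oplus>\<^bsub>V i\<^esub> y i)"
  "c \<odot>\<^bsub>family_sum I V\<^esub> x = (\<lambda>i\<in>I. c \<odot>\<^bsub>V i\<^esub> x i)"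
  by (simp_all add: family_sum_def)

lemma family_sum_carrier:
  "x \<in> carrier (family_sum I V) \<longleftrightarrow>
     x \<in> extensional I \<and> (\<forall>i\<in>I. x i \<in> carrier (V i)) \<and> finite {i \<in> I. x i \<noteq> \<zero>\<^bsub>V i\<^esub>}"
  by (auto simp: family_sum_def PiE_iff)

lemma cvs_family_sum:
  assumes "\<And>i. i \<in> I \<Longrightarrow> cvs (V i)"
  shows "cvs (family_sum I V)"
proof -
  note Vd = cvsD[OF assms]
  have ad: "finite {i \<in> I. x i \<oplus>\<^bsub>V i\<^esub> y i \<noteq> \<zero>\<^bsub>V i\<^esub>}"
    if "finite {i \<in> I. x i \<noteq> \<zero>\<^bsub>V i\<^esub>}" "finite {i \<in> I. y i \<noteq> \<zero>\<^bsub>V i\<^esub>}" for x y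
    by (rule finite_subset[OF _ finite_UnI[OF that]]) (use Vd in auto)
  have sm: "finite {i \<in> I. c \<odot>\<^bsub>V i\<^esub> x i \<noteq> \<zero>\<^bsub>V i\<^esub>}" 
    if "finite {i \<in> I. x i \<noteq> \<zero>\<^bsub>V i\<^esub>}" for x c
    by (rule finite_subset[OF _ that]) (use Vd in auto)
  have ad': "finite {i \<in> I. restrict f I i \<noteq> \<zero>\<^bsub>V i\<^esub>} \<longleftrightarrow> finite {i \<in> I. f i \<noteq> \<zero>\<^bsub>V i\<^esub>}" for f
    by (rule arg_cong[of _ _ finite]) auto
  show ?thesis
  proof (rule cvsI, goal_cases)
    case (4 v w)
    then show ?case
      unfolding family_sum_sel family_sum_carrier by (intro restrict_ext Vd(4)) auto
  next
    case (5 u v w)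
    then show ?case
      unfolding family_sum_sel family_sum_carrier by (intro restrict_ext) (simp add: Vd(2,5))
  qed (unfold family_sum_sel family_sum_carrier ad',
      auto simp: Vd(1-3,6-) ad sm extensional_def restrict_def fun_eq_iff)
qed

lemma vdim_family_sum:
  assumes "finite I" "\<And>i. i \<in> I \<Longrightarrow> cvs (V i)"
  shows "vdim (family_sum I V) = (\<Sum>i\<in>I. vdim (V i))"
  using assms
proof (induction I)
  case empty
  have "cvs (family_sum {} V)" by (rule cvs_family_sum) simp
  then show ?case
    by (simp add: vdim_eq_0 set_eq_iff family_sum_carrier restrict_def)
next
  case (insert k I)
  let ?S = "family_sum (insert k I) V" and ?T = "family_sum I V"
  have k: "cvs (V k)" and T: "cvs ?T" and S: "cvs ?S"
    using insert.prems cvs_family_sum[of I V] cvs_family_sum[of "insert k I" V] by auto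
  \<comment> \<open>split off the component at the new index\<close>
  let ?f = "\<lambda>x. (x k, restrict x I)"
  have "?f \<in> lin ?S (direct_sum (V k) ?T)"
    using insert.hyps
    by (intro linI) (auto simp: family_sum_carrier direct_sum_def restrict_def fun_eq_iff extensional_def)
  moreover have "bij_betw ?f (carrier ?S) (carrier (direct_sum (V k) ?T))"
    by (rule bij_betw_byWitness[of _ "\<lambda>(a, y). (\<lambda>i\<in>insert k I. if i = k then a else y i)"])
      (use insert.hyps in
        \<open>auto simp: family_sum_carrier direct_sum_def extensional_def fun_eq_iff\<close>)
  ultimately have "vdim ?S = vdim (V k) + vdim ?T"
    using vdim_eq_if_bij[OF S direct_sum_is_vs[OF k T]] vdim_direct_sum[OF k T] by simp
  then show ?case using insert by simp
qed

section \<open>Singular cohomology as a vector space\<close>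

lemma cochain_space_sel:
  "f \<in> carrier (cochain_space k X) \<longleftrightarrow>
     (\<forall>c\<in>singular_chain_set k X. \<forall>d\<in>singular_chain_set k X. f (c + d) = f c + f d) \<and>
     f \<in> extensional (singular_chain_set k X)"
  "\<zero>\<^bsub>cochain_space k X\<^esub> = (\<lambda>c\<in>singular_chain_set k X. 0)"
  "f \<oplus>\<^bsub>cochain_space k X\<^esub> g = (\<lambda>c\<in>singular_chain_set k X. f c + g c)"
  "a \<odot>\<^bsub>cochain_space k X\<^esub> f = (\<lambda>c\<in>singular_chain_set k X. a * f c)"
  by (auto simp: cochain_space_def hom_def)

lemma cvs_cochain_space: "cvs (cochain_space k X)"
  by (rule cvsI; unfold cochain_space_sel)
    (auto simp: singular_chain_add algebra_simps extensional_def restrict_def fun_eq_iff)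

lemma coboundary_closed:
  assumes "f \<in> carrier (cochain_space k X)"
  shows "coboundary k X f \<in> carrier (cochain_space (Suc k) X)"
  using assms unfolding cochain_space_sel coboundary_def
  by (auto simp: singular_chain_boundary_alt singular_chain_add chain_boundary_add)

lemma coboundary_lin: "coboundary k X \<in> lin (cochain_space k X) (cochain_space (Suc k) X)"
  by (rule linI, erule coboundary_closed)
    (auto simp: cochain_space_sel coboundary_def singular_chain_boundary_alt fun_eq_iff)

lemma coboundary_coboundary:
  assumes f: "f \<in> carrier (cochain_space k X)"
  shows "coboundary (Suc k) X (coboundary k X f) = \<zero>\<^bsub>cochain_space (Suc (Suc k)) X\<^esub>"
proof -
  have "f (0 + 0) = f 0 + f 0" using f unfolding cochain_space_sel by blast
  then have "f 0 = 0" by simp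
  then show ?thesis
    unfolding coboundary_def cochain_space_sel
    by (auto simp: fun_eq_iff singular_chain_boundary_alt chain_boundary_boundary_alt)
qed

text \<open>Cocycles are the kernel and coboundaries the image of a linear map, and the square of the
  coboundary vanishes, so cohomology is a quotient of a vector space by a subspace.\<close>

lemma cvs_cohomology: "cvs (cohomology k X)"
proof -
  note cs = cvs_cochain_space
  have Z: "lin_subspace (cochain_space k X) (cocycles k X)"
    unfolding lin_subspace_def cocycles_def
    using cvsD[OF cs[of k X]] linD[OF coboundary_lin[of k X]] cvsD[OF cs[of "Suc k" X]]
      lin_zero[OF cs cs coboundary_lin[of k X]]
    by auto
  have BZ: "coboundaries k X \<subseteq> cocycles k X"
  proof (cases k)
    case 0
    then show ?thesis using Z by (auto simp: coboundaries_def lin_subspace_def)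
  next
    case (Suc i)
    then show ?thesis
      using coboundary_coboundary coboundary_closed by (auto simp: coboundaries_def cocycles_def)
  qed
  have B: "lin_subspace (cochain_space k X) (coboundaries k X)"
  proof (cases k)
    case 0
    then show ?thesis
      using cvsD[OF cs[of 0 X]] by (auto simp: coboundaries_def lin_subspace_def)
  next
    case (Suc i)
    have "lin_subspace (cochain_space i X) (carrier (cochain_space i X))"
      using cvsD[OF cs[of i X]] by (auto simp: lin_subspace_def)
    then show ?thesis
      using lin_image[OF cs cs coboundary_lin, of i X] Suc by (simp add: coboundaries_def)
  qed
  show ?thesis unfolding cohomology_def
    by (rule cvs_quotient_space[OF cvs_subspace[OF cs Z] lin_subspace_restrict[OF B BZ]])
qed

lemma cvs_even_cohomology: "cvs (even_cohomology P l a)"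
proof -
  note Vd = cvsD[OF cvs_cohomology[of 0 "sector_space P l"]]
  have "lin_subspace (cohomology 0 (sector_space P l)) {\<zero>\<^bsub>cohomology 0 (sector_space P l)\<^esub>}"
    using Vd by (auto simp: lin_subspace_def)
  then show ?thesis
    unfolding even_cohomology_def using cvs_cohomology cvs_subspace by auto
qed

lemma vdim_even_cohomology_eq_0:
  assumes "a \<notin> \<nat>"
  shows "vdim (even_cohomology P l a) = 0"
  using assms by (intro vdim_eq_0 cvs_even_cohomology) (simp add: even_cohomology_def)

section \<open>Filtrations of a bigraded direct sum\<close>

text \<open>Both filtrations, their intersections and the contribution of a set of sectors are
  of this form for suitable \<open>Q\<close>.\<close>

definition bigraded_part ::
  "'s set \<Rightarrow> ('s \<Rightarrow> nat \<Rightarrow> (complex, 'a, 'm) module_scheme) \<Rightarrow> ('s \<Rightarrow> nat \<Rightarrow> bool) \<Rightarrow>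
   ('s \<Rightarrow> nat \<Rightarrow> 'a) set" where
  "bigraded_part S M Q = {x \<in> carrier (family_sum S (\<lambda>l. family_sum UNIV (M l))).
     \<forall>l\<in>S. \<forall>j. x l j \<noteq> \<zero>\<^bsub>M l j\<^esub> \<longrightarrow> Q l j}"

lemma bigraded_carrier:
  assumes "finite S"
  shows "x \<in> carrier (family_sum S (\<lambda>l. family_sum UNIV (M l))) \<longleftrightarrow>
    x \<in> extensional S \<and> (\<forall>l\<in>S. (\<forall>j. x l j \<in> carrier (M l j)) \<and> finite {j. x l j \<noteq> \<zero>\<^bsub>M l j\<^esub>})"
  using assms by (simp add: family_sum_carrier)

lemma lin_subspace_bigraded_part:
  assumes S: "finite S" and M: "\<And>l j. l \<in> S \<Longrightarrow> cvs (M l j)"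
  shows "lin_subspace (family_sum S (\<lambda>l. family_sum UNIV (M l))) (bigraded_part S M Q)"
proof -
  note Vd = cvsD[OF M]
  let ?H = "family_sum S (\<lambda>l. family_sum UNIV (M l))"
  have H: "cvs ?H" by (intro cvs_family_sum M)
  note Hd = cvsD(1-3)[OF H]
  show ?thesis
    unfolding lin_subspace_def
  proof (intro conjI ballI allI)
    show "bigraded_part S M Q \<subseteq> carrier ?H" by (auto simp: bigraded_part_def)
    show "\<zero>\<^bsub>?H\<^esub> \<in> bigraded_part S M Q"
      using Hd(1) by (auto simp: bigraded_part_def)
  next
    fix x y assume xy: "x \<in> bigraded_part S M Q" "y \<in> bigraded_part S M Q"
    then have "x \<oplus>\<^bsub>?H\<^esub> y \<in> carrier ?H" using Hd(2) by (auto simp: bigraded_part_def)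
    moreover have "Q l j" if "l \<in> S" "x l j \<oplus>\<^bsub>M l j\<^esub> y l j \<noteq> \<zero>\<^bsub>M l j\<^esub>" for l j
      using xy that Vd(1,6)[OF that(1)] unfolding bigraded_part_def by force
    ultimately show "x \<oplus>\<^bsub>?H\<^esub> y \<in> bigraded_part S M Q"
      by (simp add: bigraded_part_def)
  next
    fix c x assume x: "x \<in> bigraded_part S M Q"
    then have "c \<odot>\<^bsub>?H\<^esub> x \<in> carrier ?H" using Hd(3) by (auto simp: bigraded_part_def)
    moreover have "Q l j" if "l \<in> S" "c \<odot>\<^bsub>M l j\<^esub> x l j \<noteq> \<zero>\<^bsub>M l j\<^esub>" for l j
      using x that Vd(13)[OF that(1)] unfolding bigraded_part_def by force
    ultimately show "c \<odot>\<^bsub>?H\<^esub> x \<in> bigraded_part S M Q"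
      by (simp add: bigraded_part_def)
  qed
qed

text \<open>When the component with index \<open>(l, j)\<close> has degree \<open>f l j\<close> for the decreasing filtration and
  \<open>w l j\<close> for the increasing one, taking the graded piece of bidegree \<open>(p, m)\<close> selects the
  components with exactly these degrees. Each \<open>l\<close> is assumed to contribute at most one
  index \<open>J l\<close>, so that the selected components are indexed by a set \<open>L\<close>. The surjection to be
  used is the projection to these components.\<close>

lemma vdim_gr_F_gr_W_bigraded:
  fixes M :: "'s \<Rightarrow> nat \<Rightarrow> (complex, 'a) module" and f w :: "'s \<Rightarrow> nat \<Rightarrow> int"
  assumes S: "finite S" and M: "\<And>l j. l \<in> S \<Longrightarrow> cvs (M l j)"
    and L: "L \<subseteq> S \<inter> A" and J: "\<And>l. l \<in> L \<Longrightarrow> f l (J l) = p \<and> w l (J l) = m"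
    and LJ: "\<And>l j. l \<in> S \<Longrightarrow> l \<in> A \<Longrightarrow> f l j = p \<Longrightarrow> w l j = m \<Longrightarrow> l \<in> L \<and> j = J l"
  shows "vdim (gr_F_gr_W (family_sum S (\<lambda>l. family_sum UNIV (M l)))
      (\<lambda>p. bigraded_part S M (\<lambda>l j. l \<in> A \<and> p \<le> f l j))
      (\<lambda>m. bigraded_part S M (\<lambda>l j. l \<in> A \<and> w l j \<le> m)) p m)
    = (\<Sum>l\<in>L. vdim (M l (J l)))"
proof -
  let ?H = "family_sum S (\<lambda>l. family_sum UNIV (M l))"
  let ?F = "\<lambda>p. bigraded_part S M (\<lambda>l j. l \<in> A \<and> p \<le> f l j)"
  let ?W = "\<lambda>m. bigraded_part S M (\<lambda>l j. l \<in> A \<and> w l j \<le> m)"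
  let ?B = "family_sum L (\<lambda>l. M l (J l))"
  note Vd = cvsD[OF M]
  have LS: "l \<in> S" "l \<in> A" if "l \<in> L" for l using L that by auto
  have finL: "finite L" using L S finite_subset by blast
  have H: "cvs ?H" by (intro cvs_family_sum M)
  have B: "cvs ?B" by (intro cvs_family_sum M LS)
  have sub: "lin_subspace ?H (bigraded_part S M Q)" for Q
    by (rule lin_subspace_bigraded_part[OF S M])
  let ?g = "\<lambda>x. \<lambda>l\<in>L. x l (J l)"
  have mem: "x l j \<in> carrier (M l j)" if "x \<in> bigraded_part S M Q" "l \<in> S" for x l j Q
    using that by (auto simp: bigraded_part_def bigraded_carrier[OF S])
  have mask: "(\<lambda>l\<in>S. \<lambda>j. if R l j then x l j else \<zero>\<^bsub>M l j\<^esub>) \<in> bigraded_part S M (\<lambda>l j. Q l j \<and> R l j)"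
    if x: "x \<in> bigraded_part S M Q" for x Q R
  proof -
    have xc: "x \<in> carrier ?H" and xQ: "\<And>l j. l \<in> S \<Longrightarrow> x l j \<noteq> \<zero>\<^bsub>M l j\<^esub> \<Longrightarrow> Q l j"
      using x unfolding bigraded_part_def by blast+
    have fin: "finite {j. (if R l j then x l j else \<zero>\<^bsub>M l j\<^esub>) \<noteq> \<zero>\<^bsub>M l j\<^esub>}" if "l \<in> S" for l
    proof (rule finite_subset)
      show "finite {j. x l j \<noteq> \<zero>\<^bsub>M l j\<^esub>}"
        using xc that unfolding bigraded_carrier[OF S] by blast
    qed auto
    have "(\<lambda>l\<in>S. \<lambda>j. if R l j then x l j else \<zero>\<^bsub>M l j\<^esub>) \<in> carrier ?H"
      unfolding bigraded_carrier[OF S]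
      using fin mem[OF x] Vd(1) by simp
    then show ?thesis using xQ by (simp add: bigraded_part_def)
  qed
  have mono: "bigraded_part S M Q \<subseteq> bigraded_part S M R" if "\<And>l j. Q l j \<Longrightarrow> R l j" for Q R
    using that by (auto simp: bigraded_part_def)
  have "vdim (gr_F_gr_W ?H ?F ?W p m) = vdim ?B"
  proof (rule vdim_gr_F_gr_W[OF H B, where g = ?g])
    show "lin_subspace ?H (?F p')" "lin_subspace ?H (?W m')" for p' m' by (rule sub)+
    show "?F (p + 1) \<subseteq> ?F p" "?W (m - 1) \<subseteq> ?W m" by (rule mono; simp)+
    show "?g \<in> lin (?H\<lparr>carrier := ?F p \<inter> ?W m\<rparr>) ?B"
      by (rule linI) (use LS finL in
        \<open>auto simp: family_sum_carrier[of _ L] mem intro!: restrict_ext\<close>)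
    show "?g ` (?F p \<inter> ?W m) = carrier ?B"
    proof
      show "?g ` (?F p \<inter> ?W m) \<subseteq> carrier ?B"
        using LS finL by (auto simp: family_sum_carrier[of _ L] mem)
      show "carrier ?B \<subseteq> ?g ` (?F p \<inter> ?W m)"
      proof
        fix y assume y: "y \<in> carrier ?B"
        define x where "x = (\<lambda>l\<in>S. \<lambda>j. if l \<in> L \<and> j = J l then y l else \<zero>\<^bsub>M l j\<^esub>)"
        have "finite {j. (if l \<in> L \<and> j = J l then y l else \<zero>\<^bsub>M l j\<^esub>) \<noteq> \<zero>\<^bsub>M l j\<^esub>}" for l
          by (rule finite_subset[of _ "{J l}"]) auto
        then have "x \<in> carrier ?H"
          using y Vd(1) by (auto simp: x_def bigraded_carrier[OF S] family_sum_carrier[of _ L])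
        then have "x \<in> ?F p \<inter> ?W m"
          using J LS by (auto simp: bigraded_part_def x_def split: if_splits)
        moreover have "?g x = y"
          using y LS(1)
          by (auto simp: x_def family_sum_carrier[of _ L] extensional_def fun_eq_iff)
        ultimately show "y \<in> ?g ` (?F p \<inter> ?W m)" by blast
      qed
    qed
  next
    fix x assume x: "x \<in> ?F p \<inter> ?W m"
    have "?g x = \<zero>\<^bsub>?B\<^esub> \<longleftrightarrow> (\<forall>l\<in>L. x l (J l) = \<zero>\<^bsub>M l (J l)\<^esub>)"
      by (auto simp: fun_eq_iff restrict_def)
    also have "\<dots> \<longleftrightarrow> (\<exists>y\<in>?F (p + 1) \<inter> ?W m. \<exists>z\<in>?W (m - 1). x = z \<oplus>\<^bsub>?H\<^esub> y)"
    proof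
      \<comment> \<open>split \<open>x\<close> into the components of \<open>F\<close>-degree above \<open>p\<close> and those of degree \<open>p\<close>; the
        latter lie in \<open>W (m - 1)\<close>, because those of weight \<open>m\<close> are the ones that vanish\<close>
      assume 0: "\<forall>l\<in>L. x l (J l) = \<zero>\<^bsub>M l (J l)\<^esub>"
      let ?y = "\<lambda>l\<in>S. \<lambda>j. if p + 1 \<le> f l j then x l j else \<zero>\<^bsub>M l j\<^esub>"
      let ?z = "\<lambda>l\<in>S. \<lambda>j. if f l j \<le> p then x l j else \<zero>\<^bsub>M l j\<^esub>"
      have xF: "x \<in> ?F p" and xW: "x \<in> ?W m" using x by auto
      have y1: "?y \<in> ?F (p + 1)"
        using mask[OF xF, of "\<lambda>l j. p + 1 \<le> f l j"] mono by (rule subsetD[rotated]) auto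
      have y2: "?y \<in> ?W m"
        using mask[OF xW, of "\<lambda>l j. p + 1 \<le> f l j"] mono by (rule subsetD[rotated]) auto
      have zz: "?z \<in> bigraded_part S M (\<lambda>l j. (l \<in> A \<and> w l j \<le> m) \<and> f l j \<le> p)"
        by (rule mask[OF xW])
      have "?z \<in> ?W (m - 1)"
      proof -
        have "w l j \<le> m - 1" if "l \<in> S" "f l j \<le> p" "x l j \<noteq> \<zero>\<^bsub>M l j\<^esub>" for l j
        proof -
          have "l \<in> A" "p \<le> f l j" "w l j \<le> m" using xF xW that by (auto simp: bigraded_part_def)
          then show ?thesis using LJ[of l j] 0 that by force
        qed
        then show ?thesis using zz by (auto simp: bigraded_part_def)
      qed
      moreover have "x = ?z \<oplus>\<^bsub>?H\<^esub> ?y"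
      proof
        fix l
        show "x l = (?z \<oplus>\<^bsub>?H\<^esub> ?y) l"
        proof (cases "l \<in> S")
          case True
          then show ?thesis using mem[OF xF True] Vd(6,7)[OF True] by (auto simp: fun_eq_iff)
        next
          case False
          then show ?thesis
            using xF by (auto simp: bigraded_part_def bigraded_carrier[OF S] extensional_def)
        qed
      qed
      ultimately show "\<exists>y\<in>?F (p + 1) \<inter> ?W m. \<exists>z\<in>?W (m - 1). x = z \<oplus>\<^bsub>?H\<^esub> y"
        using y1 y2 by blast
    next
      assume "\<exists>y\<in>?F (p + 1) \<inter> ?W m. \<exists>z\<in>?W (m - 1). x = z \<oplus>\<^bsub>?H\<^esub> y"
      then obtain y z where y: "y \<in> ?F (p + 1)" and z: "z \<in> ?W (m - 1)" and xe: "x = z \<oplus>\<^bsub>?H\<^esub> y"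
        by blast
      show "\<forall>l\<in>L. x l (J l) = \<zero>\<^bsub>M l (J l)\<^esub>"
      proof
        fix l assume l: "l \<in> L"
        have "y l (J l) = \<zero>\<^bsub>M l (J l)\<^esub>" "z l (J l) = \<zero>\<^bsub>M l (J l)\<^esub>"
          using y z J[OF l] LS[OF l] by (fastforce simp: bigraded_part_def)+
        then show "x l (J l) = \<zero>\<^bsub>M l (J l)\<^esub>"
          using LS[OF l] Vd(1,6)[OF LS(1)[OF l]] by (simp add: xe)
      qed
    qed
    finally show "?g x = \<zero>\<^bsub>?B\<^esub> \<longleftrightarrow>
      (\<exists>y\<in>?F (p + 1) \<inter> ?W m. \<exists>z\<in>?W (m - 1). x = z \<oplus>\<^bsub>?H\<^esub> y)" .
  qed
  also have "\<dots> = (\<Sum>l\<in>L. vdim (M l (J l)))"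
    by (rule vdim_family_sum[OF finL]) (rule M, rule LS)
  finally show ?thesis .
qed

section \<open>Cones, boxes and ages\<close>

lemma proper_face_0_notin_affine_hull:
  fixes P :: "'a::euclidean_space set"
  assumes "convex P" "0 \<in> interior P" "S face_of P" "S \<noteq> P"
  shows "0 \<notin> affine hull S"
proof
  assume "0 \<in> affine hull S"
  then have "0 \<in> S"
    using face_of_imp_eq_affine_Int[OF assms(1,3)] assms(2) interior_subset by blast
  then show False using face_of_disjoint_interior[OF assms(3,4)] assms(2) by blast
qed

text \<open>A proper face is visible from the interior point \<open>0\<close>: were a point of \<open>P\<close> beyond \<open>s\<close> on
  the ray through \<open>s\<close>, then \<open>s\<close> would be interior to a segment of \<open>P\<close> starting at \<open>0\<close>, and the
  face would contain \<open>0\<close>. Hence every ray meets the union of the proper faces at most once.\<close>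

lemma proper_face_scaling_le_1:
  fixes P :: "'a::euclidean_space set"
  assumes "convex P" "0 \<in> interior P" "S face_of P" "S \<noteq> P"
    and s: "s \<in> S" and P: "t *\<^sub>R s \<in> P"
  shows "t \<le> 1"
proof (rule ccontr)
  assume t: "\<not> t \<le> 1"
  have n0: "0 \<notin> S" using proper_face_0_notin_affine_hull[OF assms(1-4)] hull_inc by metis
  then have "s \<noteq> 0" using s by auto
  have "s \<in> open_segment 0 (t *\<^sub>R s)"
    unfolding in_segment using t \<open>s \<noteq> 0\<close> by (auto intro!: exI[of _ "1 / t"])
  then have "0 \<in> S" using face_ofD[OF assms(3) \<open>s \<in> open_segment 0 (t *\<^sub>R s)\<close> _ _ s] assms(2) P interior_subset by blast
  then show False using n0 by blast
qed

lemma mem_convex_cone_hull_convex: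
  assumes "convex S"
  shows "x \<in> convex_cone hull S \<longleftrightarrow> x = 0 \<or> (\<exists>t\<ge>0. \<exists>s\<in>S. x = t *\<^sub>R s)"
  using assms by (auto simp: convex_cone_hull_convex_hull hull_same)

lemma independent_coeff_unique:
  fixes C :: "'a::real_vector set"
  assumes "independent C" "finite C" "(\<Sum>b\<in>C. u b *\<^sub>R b) = (\<Sum>b\<in>C. v b *\<^sub>R b)" "b \<in> C"
  shows "u b = v b"
proof -
  have "(\<Sum>b\<in>C. (u b - v b) *\<^sub>R b) = 0"
    using assms(3) by (simp add: scaleR_diff_left sum_subtractf)
  then show ?thesis using independentD[OF assms(1,2) subset_refl _ assms(4)] by fastforce
qed

text \<open>If a point with the single coordinate \<open>b\<close> is strictly between two points of the cone, the
  other coordinates of these two points are nonnegative with a positive combination equal to \<open>0\<close>, so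
  they vanish.\<close>

lemma independent_cone_face:
  fixes C :: "'a::euclidean_space set"
  assumes C: "independent C" and b: "b \<in> C"
  shows "convex_cone hull {b} face_of convex_cone hull C"
proof -
  have fin: "finite C" using C by (rule independent_imp_finite)
  have cone: "x \<in> convex_cone hull C \<longleftrightarrow> (\<exists>q. (\<forall>c\<in>C. 0 \<le> q c) \<and> x = (\<Sum>c\<in>C. q c *\<^sub>R c))" for x
  proof
    assume "x \<in> convex_cone hull C"
    moreover have "convex_cone {x. \<exists>q. (\<forall>c\<in>C. 0 \<le> q c) \<and> x = (\<Sum>c\<in>C. q c *\<^sub>R c)}" (is "convex_cone ?K")
      unfolding convex_cone_iff
    proof (intro conjI ballI allI impI)
      show "0 \<in> ?K" by (auto intro!: exI[of _ "\<lambda>_. 0"])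
      fix x y assume "x \<in> ?K" "y \<in> ?K"
      then obtain q r where "\<forall>c\<in>C. 0 \<le> q c" "x = (\<Sum>c\<in>C. q c *\<^sub>R c)"
        "\<forall>c\<in>C. 0 \<le> r c" "y = (\<Sum>c\<in>C. r c *\<^sub>R c)" by blast
      then show "x + y \<in> ?K"
        by (auto intro!: exI[of _ "\<lambda>c. q c + r c"] simp: scaleR_add_left sum.distrib)
    next
      fix x and k :: real assume "x \<in> ?K" "0 \<le> k"
      then obtain q where "\<forall>c\<in>C. 0 \<le> q c" "x = (\<Sum>c\<in>C. q c *\<^sub>R c)" by blast
      then show "k *\<^sub>R x \<in> ?K" using \<open>0 \<le> k\<close>
        by (auto intro!: exI[of _ "\<lambda>c. k * q c"] simp: scaleR_sum_right)
    qed
    moreover have "C \<subseteq> ?K"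
    proof
      fix x assume "x \<in> C"
      then show "x \<in> ?K" using fin
        by (auto intro!: exI[of _ "\<lambda>c. if c = x then 1 else 0"] simp: if_distrib[of "\<lambda>a. a *\<^sub>R _"] cong: if_cong)
    qed
    ultimately show "\<exists>q. (\<forall>c\<in>C. 0 \<le> q c) \<and> x = (\<Sum>c\<in>C. q c *\<^sub>R c)"
      using hull_minimal[of C ?K convex_cone] by blast
  next
    have "(\<Sum>c\<in>D. q c *\<^sub>R c) \<in> convex_cone hull C" if "finite D" "D \<subseteq> C" "\<forall>c\<in>D. 0 \<le> q c" for q D
      using that by (induction D)
        (auto intro!: convex_cone_hull_add convex_cone_hull_mul convex_cone_hull_contains_0
          intro: hull_inc)
    then show "\<exists>q. (\<forall>c\<in>C. 0 \<le> q c) \<and> x = (\<Sum>c\<in>C. q c *\<^sub>R c) \<Longrightarrow> x \<in> convex_cone hull C"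
      using fin by blast
  qed
  have ray: "x \<in> convex_cone hull {b} \<longleftrightarrow> (\<exists>t\<ge>0. x = t *\<^sub>R b)" for x
    by (auto simp: mem_convex_cone_hull_convex intro: exI[of _ 0])
  show ?thesis
    unfolding face_of_def
  proof (intro conjI ballI impI)
    show "convex_cone hull {b} \<subseteq> convex_cone hull C" using b by (intro hull_mono) auto
    show "convex (convex_cone hull {b})" by (rule convex_convex_cone_hull)
    fix x y z assume x: "x \<in> convex_cone hull C" and y: "y \<in> convex_cone hull C"
      and z: "z \<in> convex_cone hull {b}" and seg: "z \<in> open_segment x y"
    obtain q where q: "\<forall>c\<in>C. 0 \<le> q c" "x = (\<Sum>c\<in>C. q c *\<^sub>R c)" using x cone by blast
    obtain r where r: "\<forall>c\<in>C. 0 \<le> r c" "y = (\<Sum>c\<in>C. r c *\<^sub>R c)" using y cone by blast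
    obtain t where t: "0 \<le> t" "z = t *\<^sub>R b" using z ray by blast
    obtain u where u: "0 < u" "u < 1" "z = (1 - u) *\<^sub>R x + u *\<^sub>R y" using seg in_segment(2) by blast
    have tb: "t *\<^sub>R b = (\<Sum>c\<in>C. (if c = b then t else 0) *\<^sub>R c)"
      using fin b by (simp add: if_distrib[of "\<lambda>a. a *\<^sub>R _"] cong: if_cong)
    have "(\<Sum>c\<in>C. ((1 - u) * q c + u * r c) *\<^sub>R c) = (\<Sum>c\<in>C. (if c = b then t else 0) *\<^sub>R c)"
      using u(3) t(2) unfolding tb q(2) r(2)
      by (simp add: scaleR_sum_right scaleR_add_left sum.distrib)
    then have e: "(1 - u) * q c + u * r c = (if c = b then t else 0)" if "c \<in> C" for c
      using independent_coeff_unique[OF C fin, of "\<lambda>c. (1 - u) * q c + u * r c"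
          "\<lambda>c. if c = b then t else 0"] that by blast
    have z0: "q c = 0 \<and> r c = 0" if "c \<in> C" "c \<noteq> b" for c
    proof -
      have "(1 - u) * q c + u * r c = 0" "0 \<le> (1 - u) * q c" "0 \<le> u * r c"
        using e[OF that(1)] that q(1) r(1) u by auto
      then have "(1 - u) * q c = 0" "u * r c = 0" by linarith+
      then show ?thesis using u by simp
    qed
    have "x = q b *\<^sub>R b" "y = r b *\<^sub>R b"
      unfolding q(2) r(2) using z0 fin b by (simp_all add: sum.remove[of C b] )
    then show "x \<in> convex_cone hull {b}" "y \<in> convex_cone hull {b}" using ray q(1) r(1) b by blast+
  qed
qed

text \<open>The affine hull of a proper face misses \<open>0\<close>, so the affinely independent vertices of the
  face are linearly independent. No further vertex of \<open>P\<close> lies on a ray of the cone: by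
  \<open>proper_face_scaling_le_1\<close> it would not be beyond the face, and an extreme point is not strictly
  between \<open>0\<close> and a point of the face.\<close>

lemma proper_face_vertices:
  fixes P :: "(real ^ 'n) set"
  assumes P: "simplicial_lattice_polytope P" and 0: "0 \<in> interior P"
    and S: "S face_of P" "S \<noteq> P"
  obtains C where "independent C" "\<not> affine_dependent C" "S = convex hull C"
    "ray_vertices P (convex_cone hull S) = C" "C \<subseteq> vertices P"
    "dim (convex_cone hull S) = card C"
proof -
  have cP: "convex P" using P by (simp add: simplicial_lattice_polytope_def polytope_imp_convex)
  obtain k where "k simplex S" using P S by (auto simp: simplicial_lattice_polytope_def)
  then obtain C where C: "\<not> affine_dependent C" "S = convex hull C" by (auto simp: simplex_def)
  have n0: "0 \<notin> affine hull C"
    using proper_face_0_notin_affine_hull[OF cP 0 S] C(2) by (simp add: affine_hull_convex_hull)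
  have nC: "0 \<notin> C" using n0 hull_inc by metis
  have fin: "finite C" using C(1) aff_independent_finite by blast
  have "\<not> affine_dependent (insert 0 C)" using affine_independent_insert[OF C(1) n0] .
  then have ind: "independent C" using affine_dependent_iff_dependent[OF nC] by simp
  have SP: "S \<subseteq> P" using S(1) face_of_imp_subset by blast
  have ext: "b \<in> vertices P \<and> b \<in> S \<longleftrightarrow> b \<in> C" for b
    using extreme_point_of_face[OF S(1), of b] extreme_point_of_convex_hull_affine_independent[OF C(1), of b]
      C(2) by (auto simp: vertices_def)
  have 0: "0 \<in> interior P" "0 \<in> P" using 0 interior_subset by auto
  have cone: "convex_cone hull S = convex_cone hull C"
    unfolding C(2) by (rule antisym)
      (simp_all add: hull_minimal convex_hull_subset_convex_cone_hull convex_cone_convex_cone_hull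
        hull_mono hull_subset)
  have ray: "ray_vertices P (convex_cone hull S) = C"
  proof (rule antisym)
    show "C \<subseteq> ray_vertices P (convex_cone hull S)"
      using ext independent_cone_face[OF ind] cone by (auto simp: ray_vertices_def)
    show "ray_vertices P (convex_cone hull S) \<subseteq> C"
    proof
      fix b assume "b \<in> ray_vertices P (convex_cone hull S)"
      then have b: "b extreme_point_of P" "convex_cone hull {b} face_of convex_cone hull S"
        by (auto simp: ray_vertices_def vertices_def)
      have bP: "b \<in> P" using b(1) by (simp add: extreme_point_of_def)
      have b0: "b \<noteq> 0" using extreme_point_not_in_interior[OF b(1)] 0 by metis
      have "b \<in> convex_cone hull S" using face_of_imp_subset[OF b(2)] hull_inc[of b "{b}"] by auto
      moreover have "convex S" using C(2) by (simp add: convex_convex_hull)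
      ultimately obtain t s where t: "0 \<le> t" "s \<in> S" "b = t *\<^sub>R s"
        using mem_convex_cone_hull_convex b0 by metis
      have "t \<le> 1" using proper_face_scaling_le_1[OF cP 0(1) S t(2)] t bP by blast
      moreover have "\<not> t < 1"
      proof
        assume "t < 1"
        moreover have "t \<noteq> 0" "s \<noteq> 0" using b0 t by auto
        ultimately have "b \<in> open_segment 0 s"
          unfolding in_segment using t by (auto intro!: exI[of _ t])
        then show False using b(1) 0 t(2) SP by (auto simp: extreme_point_of_def)
      qed
      ultimately have "b = s" using t by simp
      then show "b \<in> C" using ext b(1) t(2) by (auto simp: vertices_def)
    qed
  qed
  have "C \<subseteq> convex_cone hull C" by (rule hull_subset)
  moreover have "convex_cone hull C \<subseteq> span C"
    by (rule hull_minimal[of C "span C" convex_cone, OF span_superset convex_cone_span])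
  ultimately have "span (convex_cone hull C) = span C"
    by (metis span_mono span_span subset_antisym)
  then have "dim (convex_cone hull S) = card C"
    using ind cone by (metis dim_span dim_eq_card_independent)
  then show thesis using that ind C ray ext by blast
qed

text \<open>A nonzero vector with positive coefficients on the vertices of \<open>S\<close> is on the ray of a relative
  interior point \<open>x\<close> of \<open>S\<close>. Any proper face whose cone contains the vector contains a point of this ray,
  which must be \<open>x\<close>; and a face containing a relative interior point of \<open>S\<close> contains \<open>S\<close>.\<close>

lemma sector_cone_eq:
  fixes P :: "(real ^ 'n) set"
  assumes P: "simplicial_lattice_polytope P" and 0: "0 \<in> interior P"
    and S: "S face_of P" "S \<noteq> P" and C: "\<not> affine_dependent C" "S = convex hull C" "independent C"
    and l: "l = (\<Sum>b\<in>C. q b *\<^sub>R b)" and q: "\<And>b. b \<in> C \<Longrightarrow> 0 < q b"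
  shows "sector_cone P l = convex_cone hull S"
proof -
  have cP: "convex P" using P by (simp add: simplicial_lattice_polytope_def polytope_imp_convex)
  have cS: "convex S" using C(2) by (simp add: convex_convex_hull)
  have fin: "finite C" using C(3) by (rule independent_imp_finite)
  have main: "l \<in> convex_cone hull S \<and> (\<forall>S'. S' face_of P \<and> S' \<noteq> P \<and> l \<in> convex_cone hull S' \<longrightarrow> S \<subseteq> S')"
  proof (cases "C = {}")
    case True
    then have "l = 0" "S = {}" using l C by auto
    then show ?thesis by (simp add: convex_cone_hull_contains_0)
  next
    case False
    define Q where "Q = sum q C"
    have Q: "0 < Q" unfolding Q_def using q fin False by (intro sum_pos) auto
    define x where "x = (1 / Q) *\<^sub>R l"
    have lx: "l = Q *\<^sub>R x" using Q by (simp add: x_def)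
    have xr: "x \<in> rel_interior S"
      unfolding C(2) rel_interior_convex_hull_explicit[OF C(1)]
      using Q q by (auto intro!: exI[of _ "\<lambda>b. q b / Q"] simp: x_def l scaleR_sum_right Q_def simp flip: sum_divide_distrib)
    then have xS: "x \<in> S" using rel_interior_subset by blast
    have x0: "x \<noteq> 0" using proper_face_0_notin_affine_hull[OF cP 0 S] xS hull_inc by metis
    have "S \<subseteq> S'" if S': "S' face_of P" "S' \<noteq> P" and lS': "l \<in> convex_cone hull S'" for S'
    proof -
      have cS': "convex S'" using S'(1) face_of_imp_convex by blast
      have "l \<noteq> 0" using x0 by (auto simp: x_def)
      then obtain t y where t: "0 \<le> t" "y \<in> S'" "l = t *\<^sub>R y"
        using lS' mem_convex_cone_hull_convex[OF cS'] by metis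
      have "t \<noteq> 0" using t \<open>l \<noteq> 0\<close> by auto
      then have t0: "0 < t" using t by simp
      have e1: "x = (t / Q) *\<^sub>R y" unfolding x_def t(3) by simp
      have e2: "y = (Q / t) *\<^sub>R x" unfolding e1 using t0 Q by simp
      note e = e1 e2
      have "x \<in> P" "y \<in> P" using xS t(2) S S' face_of_imp_subset by blast+
      then have "t / Q \<le> 1" "Q / t \<le> 1"
        using proper_face_scaling_le_1[OF cP 0 S' t(2)] proper_face_scaling_le_1[OF cP 0 S xS] e by metis+
      then have "t = Q" using Q t0 by (simp add: field_simps)
      then have "x = y" using e(1) Q by simp
      then show "S \<subseteq> S'"
        using subset_of_face_of[OF S'(1), of S] face_of_imp_subset[OF S(1)] xr t(2) by blast
    qed
    moreover have "l \<in> convex_cone hull S"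
      unfolding lx using xS Q by (intro convex_cone_hull_mul hull_inc) simp_all
    ultimately show ?thesis by blast
  qed
  show ?thesis
    unfolding sector_cone_def
  proof (rule Least_equality)
    show "convex_cone hull S \<in> face_fan P \<and> l \<in> convex_cone hull S"
      using main S by (auto simp: face_fan_def)
    fix \<sigma> assume "\<sigma> \<in> face_fan P \<and> l \<in> \<sigma>"
    then obtain S' where "S' face_of P" "S' \<noteq> P" "\<sigma> = convex_cone hull S'" "l \<in> convex_cone hull S'"
      by (auto simp: face_fan_def)
    then show "convex_cone hull S \<le> \<sigma>" using main hull_mono by metis
  qed
qed

lemma age_eq:
  fixes P :: "(real ^ 'n) set"
  assumes P: "simplicial_lattice_polytope P" and 0: "0 \<in> interior P"
    and S: "S face_of P" "S \<noteq> P" and C: "\<not> affine_dependent C" "S = convex hull C" "independent C"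
    and ray: "ray_vertices P (convex_cone hull S) = C"
    and l: "l = (\<Sum>b\<in>C. q b *\<^sub>R b)" and q: "\<And>b. b \<in> C \<Longrightarrow> 0 < q b"
  shows "age P l = sum q C"
    and "sector_inv P l = (\<Sum>b\<in>C. (1 - q b) *\<^sub>R b)"
proof -
  have fin: "finite C" using C(3) by (rule independent_imp_finite)
  have sc: "ray_vertices P (sector_cone P l) = C"
    using sector_cone_eq[OF P 0 S C l q] ray by simp
  have bc: "box_coeff P l = (\<lambda>b. if b \<in> C then q b else 0)"
    unfolding box_coeff_def sc
  proof (rule the_equality)
    show "l = (\<Sum>b\<in>C. (if b \<in> C then q b else 0) *\<^sub>R b) \<and> (\<forall>b. b \<notin> C \<longrightarrow> (if b \<in> C then q b else 0) = 0)"
      unfolding l by (auto intro: sum.cong)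
    fix r assume r: "l = (\<Sum>b\<in>C. r b *\<^sub>R b) \<and> (\<forall>b. b \<notin> C \<longrightarrow> r b = 0)"
    have "(\<Sum>b\<in>C. r b *\<^sub>R b) = (\<Sum>b\<in>C. q b *\<^sub>R b)" using r l by metis
    then have "r b = q b" if "b \<in> C" for b
      using independent_coeff_unique[OF C(3) fin, of r q] that by blast
    then show "r = (\<lambda>b. if b \<in> C then q b else 0)" using r by auto
  qed
  have bq: "box_coeff P l b = q b" if "b \<in> C" for b using bc that by simp
  show "age P l = sum q C" unfolding age_def sc by (rule sum.cong) (auto simp: bq)
  show "sector_inv P l = (\<Sum>b\<in>C. (1 - q b) *\<^sub>R b)"
    unfolding sector_inv_def sc by (rule sum.cong) (auto simp: bq)
qed

text \<open>The coefficients of \<open>sector_inv P l\<close> on the vertices are \<open>1 - q b\<close>, again strictly between \<open>0\<close> and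
  \<open>1\<close>, so both vectors have the same cone and the ages add up to the number of its rays. Equivalently,
  the dimension of the sector and the two ages sum to \<open>n\<close>.\<close>

lemma age_add_age_sector_inv:
  fixes P :: "(real ^ 'n) set"
  assumes P: "simplicial_lattice_polytope P" and 0: "0 \<in> interior P" and l: "l \<in> sectors P"
  shows "age P l + age P (sector_inv P l) = real (dim (sector_cone P l))"
proof -
  obtain S where S: "S face_of P" "S \<noteq> P" and lb: "l \<in> Box P (convex_cone hull S)"
    using l by (auto simp: sectors_def face_fan_def)
  obtain C where C: "independent C" "\<not> affine_dependent C" "S = convex hull C"
    "ray_vertices P (convex_cone hull S) = C" "dim (convex_cone hull S) = card C"
    using proper_face_vertices[OF P 0 S] by metis
  obtain q where q: "l = (\<Sum>b\<in>C. q b *\<^sub>R b)" "\<And>b. b \<in> C \<Longrightarrow> 0 < q b \<and> q b < 1"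
    using lb C(4) by (auto simp: Box_def)
  note a = age_eq[OF P 0 S C(2,3,1,4)]
  have "age P l = sum q C" "sector_inv P l = (\<Sum>b\<in>C. (1 - q b) *\<^sub>R b)"
    using a[OF q(1)] q(2) by auto
  moreover from this(2) have "age P (sector_inv P l) = (\<Sum>b\<in>C. 1 - q b)"
    using a(1)[of "sector_inv P l" "\<lambda>b. 1 - q b"] q(2) by auto
  moreover have "sector_cone P l = convex_cone hull S"
    using sector_cone_eq[OF P 0 S C(2,3,1) q(1)] q(2) by auto
  ultimately show ?thesis using C(5) by (simp add: sum_subtractf)
qed

lemma finite_int_vectors_bounded:
  assumes "bounded B"
  shows "finite (int_vectors \<inter> B :: (real ^ 'n) set)"
proof -
  obtain r where r: "\<And>x. x \<in> B \<Longrightarrow> norm x \<le> r" using assms by (auto simp: bounded_iff)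
  have fin: "finite {k::int. \<bar>real_of_int k\<bar> \<le> r}"
    by (rule finite_subset[of _ "{- \<lceil>r\<rceil>..\<lceil>r\<rceil>}"]) (auto, linarith+)
  let ?T = "(\<lambda>k. (\<chi> i. real_of_int (k i)) :: real ^ 'n) ` (PiE UNIV (\<lambda>_. {k::int. \<bar>real_of_int k\<bar> \<le> r}))"
  have "int_vectors \<inter> B \<subseteq> ?T"
  proof
    fix x :: "real ^ 'n" assume x: "x \<in> int_vectors \<inter> B"
    then have i: "x $ i = real_of_int \<lfloor>x $ i\<rfloor>" for i by (auto simp: int_vectors_def)
    have "\<bar>x $ i\<bar> \<le> r" for i using component_le_norm_cart[of x i] r[of x] x by auto
    then show "x \<in> ?T"
      using i by (intro image_eqI[of _ _ "\<lambda>i. \<lfloor>x $ i\<rfloor>"]) (auto simp: vec_eq_iff)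
  qed
  moreover have "finite ?T" using fin by (intro finite_imageI finite_PiE) auto
  ultimately show ?thesis by (rule finite_subset)
qed

lemma finite_sectors:
  fixes P :: "(real ^ 'n) set"
  assumes P: "simplicial_lattice_polytope P" and 0: "0 \<in> interior P"
  shows "finite (sectors P)"
proof -
  have poly: "polytope P" using P by (simp add: simplicial_lattice_polytope_def)
  have "face_fan P \<subseteq> (\<lambda>S. convex_cone hull S) ` {S. S face_of P}" by (auto simp: face_fan_def)
  then have ff: "finite (face_fan P)" using finite_polytope_faces[OF poly] finite_surj by blast
  have "finite (Box P \<sigma>)" if \<sigma>: "\<sigma> \<in> face_fan P" for \<sigma>
  proof -
    let ?C = "ray_vertices P \<sigma>"
    have "norm v \<le> (\<Sum>b\<in>?C. norm b)" if v: "v \<in> Box P \<sigma>" for v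
    proof -
      obtain q where q: "v = (\<Sum>b\<in>?C. q b *\<^sub>R b)" "\<forall>b\<in>?C. 0 < q b \<and> q b < 1"
        using v unfolding Box_def by blast
      show ?thesis unfolding q(1)
        by (rule sum_norm_le) (use q(2) in \<open>auto intro!: mult_left_le_one_le simp: less_imp_le\<close>)
    qed
    then have "bounded (Box P \<sigma>)" by (auto simp: bounded_iff)
    moreover have "Box P \<sigma> = int_vectors \<inter> Box P \<sigma>" by (auto simp: Box_def)
    ultimately show ?thesis using finite_int_vectors_bounded by metis
  qed
  then show ?thesis unfolding sectors_def using ff by blast
qed

section \<open>Hodge numbers of the orbifold cohomology\<close>

text \<open>The filtration \<open>orb_F P p\<close> consists of the components with \<open>p \<le> hodge_F_degree P l j\<close>, and
  \<open>orb_W P m\<close> of those with \<open>hodge_W_weight P l j \<le> m\<close>; here \<open>j\<close> is half the cohomological degree. The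
  shift by one on the sectors of non-integral age occurs in both.\<close>

definition hodge_F_degree :: "(real ^ 'n) set \<Rightarrow> (real ^ 'n) \<Rightarrow> nat \<Rightarrow> int" where
  "hodge_F_degree P l j =
     int CARD('n) - (if age P l \<in> \<int> then 0 else 1) - \<lfloor>age P l\<rfloor> - int j"

definition hodge_W_weight :: "(real ^ 'n) set \<Rightarrow> (real ^ 'n) \<Rightarrow> nat \<Rightarrow> int" where
  "hodge_W_weight P l j =
     int CARD('n) - (if age P l \<in> \<int> then 0 else 1) + sector_dim P l - 2 * int j"

lemma sectors_part_eq:
  "sectors_part P A = bigraded_part (sectors P) (\<lambda>l j. even_cohomology P l (real j)) (\<lambda>l j. l \<in> A)"
  unfolding sectors_part_def bigraded_part_def orb_cohomology_def sector_cohomology_def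
  by (auto simp: fun_eq_iff)

lemma orb_F_eq:
  fixes P :: "(real ^ 'n) set"
  shows "orb_F P p = bigraded_part (sectors P) (\<lambda>l j. even_cohomology P l (real j))
    (\<lambda>l j. p \<le> hodge_F_degree P l j)"
proof -
  have e: "(\<exists>i\<ge>p. real j = (if age P l \<in> \<int> then real CARD('n) - of_int i - age P l
                else real CARD('n) - 1 - of_int i - of_int \<lfloor>age P l\<rfloor>)) \<longleftrightarrow> p \<le> hodge_F_degree P l j"
    (is "(\<exists>i\<ge>p. ?E i) \<longleftrightarrow> _") for l and j :: nat
  proof -
    have "?E i \<longleftrightarrow> i = hodge_F_degree P l j" for i
    proof (cases "age P l \<in> \<int>")
      case True
      then have "age P l = of_int \<lfloor>age P l\<rfloor>" by simp
      then have "?E i \<longleftrightarrow> real j = real CARD('n) - of_int i - of_int \<lfloor>age P l\<rfloor>" using True by simp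
      also have "\<dots> \<longleftrightarrow> real_of_int i = real_of_int (hodge_F_degree P l j)"
        using True by (auto simp: hodge_F_degree_def)
      finally show ?thesis by simp
    next
      case False
      then have "?E i \<longleftrightarrow> real_of_int i = real_of_int (hodge_F_degree P l j)"
        by (auto simp: hodge_F_degree_def)
      then show ?thesis by simp
    qed
    then show ?thesis by auto
  qed
  show ?thesis
    unfolding orb_F_def sector_F_def e bigraded_part_def orb_cohomology_def
    by (auto simp: family_sum_carrier[of _ "sectors P"] sector_cohomology_def)
qed

lemma orb_W_eq:
  fixes P :: "(real ^ 'n) set"
  shows "orb_W P m = bigraded_part (sectors P) (\<lambda>l j. even_cohomology P l (real j))
    (\<lambda>l j. hodge_W_weight P l j \<le> m)"
proof -
  have e: "(if age P l \<in> \<int> then int CARD('n) + sector_dim P l - m \<le> 2 * int j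
          else int CARD('n) - 1 + sector_dim P l - m \<le> 2 * int j) \<longleftrightarrow> hodge_W_weight P l j \<le> m"
    for l and j :: nat
    by (auto simp: hodge_W_weight_def)
  show ?thesis
    unfolding orb_W_def sector_W_def e bigraded_part_def orb_cohomology_def
    by (auto simp: family_sum_carrier[of _ "sectors P"] sector_cohomology_def)
qed

lemma bigraded_part_Int:
  "bigraded_part S M Q \<inter> bigraded_part S M R = bigraded_part S M (\<lambda>l j. Q l j \<and> R l j)"
  by (auto simp: bigraded_part_def)

text \<open>For a fixed sector \<open>hodge_F_degree P l\<close> is injective, so at most one degree of each sector
  contributes to a given Hodge number.\<close>

lemma hodge_number_sectors_part:
  fixes P :: "(real ^ 'n) set"
  assumes P: "simplicial_lattice_polytope P" and 0: "0 \<in> interior P"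
    and L: "\<And>l. l \<in> L \<longleftrightarrow> l \<in> sectors P \<and> l \<in> A \<and>
      (\<exists>j. hodge_F_degree P l j = p \<and> hodge_W_weight P l j = p + q)"
    and J: "\<And>l. l \<in> L \<Longrightarrow> hodge_F_degree P l (J l) = p"
  shows "hodge_number (restrict_hodge_data (MHS_orb P \<kappa>) (sectors_part P A)) p q =
    (\<Sum>l\<in>L. vdim (even_cohomology P l (real (J l))))"
proof -
  have inj: "j = j'" if "hodge_F_degree P l j = hodge_F_degree P l j'" for l j j'
    using that by (simp add: hodge_F_degree_def)
  have J': "hodge_F_degree P l (J l) = p \<and> hodge_W_weight P l (J l) = p + q" if "l \<in> L" for l
    using J[OF that] L[of l] that inj by metis
  have "hodge_number (restrict_hodge_data (MHS_orb P \<kappa>) (sectors_part P A)) p q =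
    vdim (gr_F_gr_W (orb_cohomology P) (\<lambda>p. orb_F P p \<inter> sectors_part P A)
      (\<lambda>m. orb_W P m \<inter> sectors_part P A) p (p + q))"
    by (simp add: hodge_number_def restrict_hodge_data_def MHS_orb_def gr_F_gr_W_carrier_update)
  also have "\<dots> = (\<Sum>l\<in>L. vdim (even_cohomology P l (real (J l))))"
    unfolding orb_F_eq orb_W_eq sectors_part_eq bigraded_part_Int orb_cohomology_def
      sector_cohomology_def
    unfolding conj_commute[of _ "_ \<in> A"]
  proof (rule vdim_gr_F_gr_W_bigraded)
    show "finite (sectors P)" by (rule finite_sectors[OF P 0])
    show "L \<subseteq> sectors P \<inter> A" using L by blast
    show "l \<in> L \<and> j = J l" if "l \<in> sectors P" "l \<in> A" "hodge_F_degree P l j = p"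
      "hodge_W_weight P l j = p + q" for l j
      using that L[of l] J'[of l] inj by metis
  qed (use J' cvs_even_cohomology in auto)
  finally show ?thesis .
qed

text \<open>The first equation determines \<open>j\<close>; substituting it into the second leaves a condition on the
  sector alone, which becomes a condition on the difference of the ages once \<open>sector_dim P l\<close> is
  expressed by the two ages.\<close>

lemma hodge_degree_int_iff:
  fixes P :: "(real ^ 'n) set"
  assumes P: "simplicial_lattice_polytope P" and 0: "0 \<in> interior P" and l: "l \<in> sectors P"
    and age: "age P l \<in> \<int>"
  shows "hodge_F_degree P l j = p \<and> hodge_W_weight P l j = p + q \<longleftrightarrow>
    age P l - age P (sector_inv P l) = of_int (q - p) \<and>
    real j = of_int (sector_dim P l) + age P (sector_inv P l) - of_int p"
proof -
  let ?a = "age P l" and ?b = "age P (sector_inv P l)"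
  have s: "?a + ?b = real (dim (sector_cone P l))" by (rule age_add_age_sector_inv[OF P 0 l])
  have a: "real_of_int \<lfloor>?a\<rfloor> = ?a" using age by simp
  have d: "real_of_int (sector_dim P l) = real CARD('n) - (?a + ?b)"
    unfolding s sector_dim_def by simp
  have "hodge_F_degree P l j = p \<longleftrightarrow> real_of_int (hodge_F_degree P l j) = of_int p" by linarith
  moreover have "hodge_W_weight P l j = p + q \<longleftrightarrow> real_of_int (hodge_W_weight P l j) = of_int (p + q)"
    by linarith
  moreover have "real_of_int (hodge_F_degree P l j) = real CARD('n) - ?a - real j"
    using age a by (simp add: hodge_F_degree_def)
  moreover have "real_of_int (hodge_W_weight P l j) =
      real CARD('n) + real_of_int (sector_dim P l) - 2 * real j"
    using age by (simp add: hodge_W_weight_def)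
  ultimately show ?thesis using d by auto
qed

text \<open>If the ages of \<open>l\<close> and of its inverse are not integers, their sum still is, and their integer
  parts sum to one less than it. The missing one is absorbed by the shift in the filtrations.\<close>

lemma hodge_degree_nonint_iff:
  fixes P :: "(real ^ 'n) set"
  assumes P: "simplicial_lattice_polytope P" and 0: "0 \<in> interior P" and l: "l \<in> sectors P"
    and age: "age P l \<notin> \<int>"
  shows "hodge_F_degree P l j = p \<and> hodge_W_weight P l j = p + q \<longleftrightarrow>
    \<lfloor>age P l\<rfloor> - \<lfloor>age P (sector_inv P l)\<rfloor> = q - p \<and>
    int j = sector_dim P l + \<lfloor>age P (sector_inv P l)\<rfloor> - p"
proof -
  let ?a = "age P l" and ?b = "age P (sector_inv P l)"
  have s: "?b = of_int (int (dim (sector_cone P l))) - ?a"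
    using age_add_age_sector_inv[OF P 0 l] by simp
  have "\<lfloor>?b\<rfloor> = int (dim (sector_cone P l)) + \<lfloor>- ?a\<rfloor>"
    unfolding s by (metis floor_add_int add.commute uminus_add_conv_diff diff_conv_add_uminus)
  also have "\<lfloor>- ?a\<rfloor> = - \<lfloor>?a\<rfloor> - 1"
  proof -
    have "of_int \<lfloor>?a\<rfloor> \<noteq> ?a" using age by (metis Ints_of_int)
    then show ?thesis by (simp add: floor_minus ceiling_altdef)
  qed
  finally have "sector_dim P l = int CARD('n) - 1 - \<lfloor>?a\<rfloor> - \<lfloor>?b\<rfloor>"
    by (simp add: sector_dim_def)
  then show ?thesis using age by (auto simp: hodge_F_degree_def hodge_W_weight_def)
qed

theorem proposition3p14:
  fixes P :: "(real ^ 'n) set"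
    and \<kappa> :: "((real ^ 'n) \<Rightarrow> nat \<Rightarrow> 'n toric_class) \<Rightarrow> ((real ^ 'n) \<Rightarrow> nat \<Rightarrow> 'n toric_class)"
    and p q :: int
  assumes "simplicial_lattice_polytope P"
    and "0 \<in> interior P"
    and "PL_conjugation P \<kappa>"
  shows "hodge_number (MHS_orb P \<kappa>) p q =
           hodge_number (restrict_hodge_data (MHS_orb P \<kappa>) (orb_cohomology_int P)) p q +
           hodge_number (restrict_hodge_data (MHS_orb P \<kappa>) (orb_cohomology_nonint P)) p q \<and>
         hodge_number (restrict_hodge_data (MHS_orb P \<kappa>) (orb_cohomology_int P)) p q =
           (\<Sum>l | l \<in> sectors P \<and> age P l \<in> \<int> \<and>
                  age P l - age P (sector_inv P l) = of_int (q - p).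
              vdim (even_cohomology P l
                (of_int (sector_dim P l) + age P (sector_inv P l) - of_int p))) \<and>
         hodge_number (restrict_hodge_data (MHS_orb P \<kappa>) (orb_cohomology_nonint P)) p q =
           (\<Sum>l | l \<in> sectors P \<and> age P l \<notin> \<int> \<and>
                  \<lfloor>age P l\<rfloor> - \<lfloor>age P (sector_inv P l)\<rfloor> = q - p.
              vdim (even_cohomology P l
                (of_int (sector_dim P l + \<lfloor>age P (sector_inv P l)\<rfloor> - p))))"
proof -
  note P = assms(1,2)
  have fin: "finite (sectors P)" by (rule finite_sectors[OF P])
  define L where "L = {l \<in> sectors P.
    \<exists>j. hodge_F_degree P l j = p \<and> hodge_W_weight P l j = p + q}"
  define J where "J l = (SOME j. hodge_F_degree P l j = p \<and> hodge_W_weight P l j = p + q)" for l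
  have J: "hodge_F_degree P l (J l) = p \<and> hodge_W_weight P l (J l) = p + q" if "l \<in> L" for l
  proof -
    have "\<exists>j. hodge_F_degree P l j = p \<and> hodge_W_weight P l j = p + q"
      using that by (simp add: L_def)
    from someI_ex[OF this] show ?thesis unfolding J_def .
  qed
  let ?v = "\<lambda>l. vdim (even_cohomology P l (real (J l)))"
  let ?I = "{l. age P l \<in> \<int>}" and ?N = "{l. age P l \<notin> \<int>}"
  have hodge: "hodge_number (restrict_hodge_data (MHS_orb P \<kappa>) (sectors_part P A)) p q =
      sum ?v (L \<inter> A)" for A
    by (rule hodge_number_sectors_part[OF P]) (use J in \<open>auto simp: L_def\<close>)
  have "restrict_hodge_data (MHS_orb P \<kappa>) (sectors_part P UNIV) = MHS_orb P \<kappa>"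
    by (auto simp: restrict_hodge_data_def MHS_orb_def sectors_part_def orb_F_def orb_W_def)
  then have "hodge_number (MHS_orb P \<kappa>) p q = sum ?v L" using hodge[of UNIV] by simp
  also have "L = L \<inter> ?I \<union> L \<inter> ?N" by blast
  also have "sum ?v (L \<inter> ?I \<union> L \<inter> ?N) = sum ?v (L \<inter> ?I) + sum ?v (L \<inter> ?N)"
    using fin by (intro sum.union_disjoint) (auto simp: L_def)
  finally have total: "hodge_number (MHS_orb P \<kappa>) p q = sum ?v (L \<inter> ?I) + sum ?v (L \<inter> ?N)" .
  \<comment> \<open>the sums in the statement may range over more sectors than \<open>L\<close>; for the additional ones the degree
    in question is not a natural number, and the summand vanishes\<close>
  have int: "sum ?v (L \<inter> ?I) = (\<Sum>l | l \<in> sectors P \<and> age P l \<in> \<int> \<and>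
                  age P l - age P (sector_inv P l) = of_int (q - p).
              vdim (even_cohomology P l
                (of_int (sector_dim P l) + age P (sector_inv P l) - of_int p)))"
  proof (rule sum.mono_neutral_cong_left)
    show "finite {l \<in> sectors P. age P l \<in> \<int> \<and> age P l - age P (sector_inv P l) = of_int (q - p)}"
      using fin by simp
    show "L \<inter> ?I \<subseteq> {l \<in> sectors P. age P l \<in> \<int> \<and> age P l - age P (sector_inv P l) = of_int (q - p)}"
      using hodge_degree_int_iff[OF P] by (auto simp: L_def)
    show "\<forall>l\<in>{l \<in> sectors P. age P l \<in> \<int> \<and> age P l - age P (sector_inv P l) = of_int (q - p)} - L \<inter> ?I.
      vdim (even_cohomology P l (of_int (sector_dim P l) + age P (sector_inv P l) - of_int p)) = 0"
    proof
      fix l assume l: "l \<in> {l \<in> sectors P. age P l \<in> \<int> \<and>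
        age P l - age P (sector_inv P l) = of_int (q - p)} - L \<inter> ?I"
      then have "real j \<noteq> of_int (sector_dim P l) + age P (sector_inv P l) - of_int p" for j
        using hodge_degree_int_iff[OF P, of l j p q] unfolding L_def by blast
      then show "vdim (even_cohomology P l
          (of_int (sector_dim P l) + age P (sector_inv P l) - of_int p)) = 0"
        by (intro vdim_even_cohomology_eq_0) (metis Nats_cases)
    qed
    fix l assume "l \<in> L \<inter> ?I"
    then show "?v l = vdim (even_cohomology P l
        (of_int (sector_dim P l) + age P (sector_inv P l) - of_int p))"
      using hodge_degree_int_iff[OF P, of l "J l" p q] J[of l] by (simp add: L_def)
  qed
  have nonint: "sum ?v (L \<inter> ?N) = (\<Sum>l | l \<in> sectors P \<and> age P l \<notin> \<int> \<and>
                  \<lfloor>age P l\<rfloor> - \<lfloor>age P (sector_inv P l)\<rfloor> = q - p.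
              vdim (even_cohomology P l
                (of_int (sector_dim P l + \<lfloor>age P (sector_inv P l)\<rfloor> - p))))"
  proof (rule sum.mono_neutral_cong_left)
    show "finite {l \<in> sectors P. age P l \<notin> \<int> \<and> \<lfloor>age P l\<rfloor> - \<lfloor>age P (sector_inv P l)\<rfloor> = q - p}"
      using fin by simp
    show "L \<inter> ?N \<subseteq> {l \<in> sectors P. age P l \<notin> \<int> \<and> \<lfloor>age P l\<rfloor> - \<lfloor>age P (sector_inv P l)\<rfloor> = q - p}"
      using hodge_degree_nonint_iff[OF P] by (auto simp: L_def)
    show "\<forall>l\<in>{l \<in> sectors P. age P l \<notin> \<int> \<and> \<lfloor>age P l\<rfloor> - \<lfloor>age P (sector_inv P l)\<rfloor> = q - p} - L \<inter> ?N.
      vdim (even_cohomology P l (of_int (sector_dim P l + \<lfloor>age P (sector_inv P l)\<rfloor> - p))) = 0"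
    proof
      fix l assume l: "l \<in> {l \<in> sectors P. age P l \<notin> \<int> \<and>
        \<lfloor>age P l\<rfloor> - \<lfloor>age P (sector_inv P l)\<rfloor> = q - p} - L \<inter> ?N"
      then have "int j \<noteq> sector_dim P l + \<lfloor>age P (sector_inv P l)\<rfloor> - p" for j
        using hodge_degree_nonint_iff[OF P, of l j p q] unfolding L_def by blast
      then show "vdim (even_cohomology P l
          (of_int (sector_dim P l + \<lfloor>age P (sector_inv P l)\<rfloor> - p))) = 0"
        by (intro vdim_even_cohomology_eq_0) (metis Nats_cases of_int_eq_iff of_int_of_nat_eq)
    qed
    fix l assume "l \<in> L \<inter> ?N"
    then have "int (J l) = sector_dim P l + \<lfloor>age P (sector_inv P l)\<rfloor> - p"
      using hodge_degree_nonint_iff[OF P, of l "J l" p q] J[of l] by (simp add: L_def)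
    then show "?v l = vdim (even_cohomology P l
        (of_int (sector_dim P l + \<lfloor>age P (sector_inv P l)\<rfloor> - p)))"
      by (metis of_int_of_nat_eq)
  qed
  show ?thesis
    unfolding orb_cohomology_int_def orb_cohomology_nonint_def hodge total int nonint by blast
qed

end
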